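(* Let $d \geq 2$ and $k \geq d+1$ be integers and let $K$ be a convex body in $\mathbb{R}^d$ with $\lambda_d(K)=1$. If $S$ is a set of $n \geq k$ points chosen uniformly and independently at random from $K$, then the expected number of $k$-islands in $S$ is at most \[2^{d-1}\cdot \left(2d^{2d-1}\binom{k}{\lfloor d/2 \rfloor}\right)^{k-d-1} \cdot (k-d) \cdot \frac{n(n-1) \cdots (n-k+2)}{(n-k+1)^{k-d-1}},\] which is in $O(n^d)$ for any fixed $d$ and $k$.
   Context: A convex body in $\mathbb{R}^d$ is a compact convex set with nonempty interior; $\lambda_d$ denotes $d$-dimensional Lebesgue measure. For a finite point set $S\subseteq\mathbb{R}^d$, a set $I$ of $k$ points of $S$ is a $k$-island in $S$ if $\mathrm{conv}(I)\cap S = I$. *)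

theory Defs
  imports "HOL-Probability.Probability" "HOL-Library.Landau_Symbols"
begin

definition convex_body :: "'a::euclidean_space set \<Rightarrow> bool" where
  "convex_body K \<longleftrightarrow> compact K \<and> convex K \<and> interior K \<noteq> {}"

(* Meant for finite S, so that every such I is finite. *)
definition k_island :: "nat \<Rightarrow> 'a::real_vector set \<Rightarrow> 'a set \<Rightarrow> bool" where
  "k_island k S I \<longleftrightarrow> I \<subseteq> S \<and> card I = k \<and> convex hull I \<inter> S = I"

definition num_k_islands :: "nat \<Rightarrow> 'a::real_vector set \<Rightarrow> nat" where
  "num_k_islands k S = card {I. k_island k S I}"

(* The product over i < k - 1 is n (n - 1) ... (n - k + 2). *)
definition islands_bound :: "nat \<Rightarrow> nat \<Rightarrow> nat \<Rightarrow> real" where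
  "islands_bound d k n =
     2 ^ (d - 1) * (2 * real d ^ (2 * d - 1) * real (k choose (d div 2))) ^ (k - d - 1)
       * (real k - real d)
       * ((\<Prod>i<k - 1. real n - real i) / (real n - real k + 1) ^ (k - d - 1))"

end

theory Submission imports Defs begin

text \<open>
  Among the simplices spanned by an island pick one of maximal volume \<open>v\<close>. In its affine coordinates
  all remaining points of the island lie in a cube of volume \<open>2\<^sup>d d! v\<close>, and all points outside the
  island avoid a set of volume \<open>v\<close>. With \<open>m = k - d - 1\<close> the probability that \<open>k\<close> given points form an
  island is therefore at most \<open>k choose (d+1)\<close> times the expectation of
  \<open>(2\<^sup>d d! v)\<^sup>m (1 - v)\<^bsup>n-k\<^esup>\<close> for the volume \<open>v\<close> of a random simplex.

  The volume of a random simplex has density at most \<open>(d+1)! 2\<^bsup>d-1\<^esup>\<close>, whatever the body. Fix a nonzero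
  vector \<open>e\<close> and write it as a combination of the vertices with coefficients of sum zero. Let \<open>q\<close> be
  the vertex whose coefficient is largest in absolute value. For fixed other vertices, use \<open>e\<close> and
  the edges of the facet opposite to \<open>q\<close> as a basis. The choice of \<open>q\<close> confines its facet coordinates
  to one half of the cube \<open>[-1, 1]\<^bsup>d-1\<^esup>\<close>, and \<open>v\<close> is proportional to the absolute value of its
  \<open>e\<close> coordinate, with a factor that cancels against the Jacobian.

  A beta integral then bounds the expected number of islands by
  \<open>2\<^bsup>d-1\<^esup> (2\<^sup>d d!)\<^sup>m n (n-1) ... (n-d+1)\<close>, which is at most the claimed bound.
\<close>

section \<open>Linear change of variables\<close>

lemma Basis_cart_eq_range: "Basis = range (\<lambda>i. axis i 1 :: real^'d)"
  by (auto simp: Basis_vec_def)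

lemma inj_axis: "inj (\<lambda>i. axis i 1 :: real^'d)"
  by (auto simp: inj_def axis_eq_axis)

text \<open>By Fubini, coordinate \<open>m\<close> can be integrated first. The shear moves it by
  \<open>x$n\<close>, which is constant along that line since \<open>m \<noteq> n\<close>, so
  one-dimensional translation invariance applies.\<close>

lemma nn_integral_lborel_shear:
  fixes G :: "real^'d \<Rightarrow> ennreal"
  assumes G [measurable]: "G \<in> borel_measurable borel" and mn: "m \<noteq> n"
  shows "(\<integral>\<^sup>+x. G (\<chi> i. if i = m then x$m + x$n else x$i) \<partial>lborel) = (\<integral>\<^sup>+x. G x \<partial>lborel)"
proof -
  interpret product_sigma_finite "\<lambda>_::real^'d. lborel :: real measure" by standard
  define e where "e = (axis m 1 :: real^'d)"
  define B where "B = Basis - {e}"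
  have e: "e \<in> Basis" by (auto simp: e_def axis_in_Basis_iff)
  have ins: "Basis = insert e B" "e \<notin> B" "finite B" using e by (auto simp: B_def)
  define S where "S = (\<lambda>y::real^'d\<Rightarrow>real. \<Sum>b\<in>B. y b *\<^sub>R b)"
  have lb: "(\<integral>\<^sup>+x. F x \<partial>lborel) = (\<integral>\<^sup>+y. (\<integral>\<^sup>+s. F (s *\<^sub>R e + S y) \<partial>lborel) \<partial>PiM B (\<lambda>_. lborel))"
    if [measurable]: "F \<in> borel_measurable borel" for F :: "real^'d \<Rightarrow> ennreal"
  proof -
    have "(\<integral>\<^sup>+x. F x \<partial>lborel) = (\<integral>\<^sup>+y. F (\<Sum>b\<in>Basis. y b *\<^sub>R b) \<partial>PiM Basis (\<lambda>_. lborel))"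
      by (subst lborel_eq) (simp add: nn_integral_distr)
    also have "\<dots> = (\<integral>\<^sup>+y. (\<integral>\<^sup>+s. F (\<Sum>b\<in>Basis. (y(e:=s)) b *\<^sub>R b) \<partial>lborel) \<partial>PiM B (\<lambda>_. lborel))"
      unfolding ins(1) using ins(2,3) by (subst product_nn_integral_insert) auto
    also have "\<dots> = (\<integral>\<^sup>+y. (\<integral>\<^sup>+s. F (s *\<^sub>R e + S y) \<partial>lborel) \<partial>PiM B (\<lambda>_. lborel))"
    proof (intro nn_integral_cong)
      fix y :: "real^'d \<Rightarrow> real" and s :: real
      have "(\<Sum>b\<in>B. (y(e:=s)) b *\<^sub>R b) = S y"
        unfolding S_def using ins(2) by (intro sum.cong) auto
      then show "F (\<Sum>b\<in>Basis. (y(e:=s)) b *\<^sub>R b) = F (s *\<^sub>R e + S y)"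
        unfolding ins(1) using ins(2,3) by simp
    qed
    finally show ?thesis .
  qed
  have h: "(\<chi> i. if i = m then x$m + x$n else x$i) = (x$n) *\<^sub>R e + x" for x :: "real^'d"
    by (auto simp: vec_eq_iff e_def axis_def)
  have en0: "e $ n = 0"
    using mn by (simp add: e_def axis_def)
  have "(\<integral>\<^sup>+x. G (\<chi> i. if i = m then x$m + x$n else x$i) \<partial>lborel)
      = (\<integral>\<^sup>+y. (\<integral>\<^sup>+s. G ((S y $ n + 1 * s) *\<^sub>R e + S y) \<partial>lborel) \<partial>PiM B (\<lambda>_. lborel))"
    unfolding h by (subst lb) (auto simp: en0 scaleR_left_distrib add.assoc)
  also have "\<dots> = (\<integral>\<^sup>+y. (\<integral>\<^sup>+s. G (s *\<^sub>R e + S y) \<partial>lborel) \<partial>PiM B (\<lambda>_. lborel))"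
  proof (rule nn_integral_cong)
    fix y :: "real^'d \<Rightarrow> real"
    show "(\<integral>\<^sup>+s. G ((S y $ n + 1 * s) *\<^sub>R e + S y) \<partial>lborel) = (\<integral>\<^sup>+s. G (s *\<^sub>R e + S y) \<partial>lborel)"
      using nn_integral_real_affine[of "\<lambda>s. G (s *\<^sub>R e + S y)" 1 "S y $ n"] by simp
  qed
  also have "\<dots> = (\<integral>\<^sup>+x. G x \<partial>lborel)" by (rule lb[symmetric]) simp
  finally show ?thesis .
qed

text \<open>The preimage of a box is the box with permuted sides, which has the same volume, and
  Lebesgue measure is determined by its values on boxes.\<close>

lemma nn_integral_lborel_permute:
  fixes G :: "real^'d \<Rightarrow> ennreal" and p :: "'d \<Rightarrow> 'd"
  assumes G [measurable]: "G \<in> borel_measurable borel" and p: "bij p"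
  shows "(\<integral>\<^sup>+x. G (\<chi> i. x $ p i) \<partial>lborel) = (\<integral>\<^sup>+x. G x \<partial>lborel)"
proof -
  let ?h = "\<lambda>x::real^'d. \<chi> i. x $ p i"
  have cont: "continuous_on UNIV ?h" by (intro continuous_intros)
  then have [measurable]: "?h \<in> borel_measurable borel" by (rule borel_measurable_continuous_onI)
  have "lborel = distr lborel borel ?h"
  proof (rule lborel_eqI)
    fix l u :: "real^'d" assume lu: "\<And>b. b \<in> Basis \<Longrightarrow> l \<bullet> b \<le> u \<bullet> b"
    let ?q = "inv p"
    have q: "p (?q i) = i" "?q (p i) = i" for i using p by (auto simp: bij_is_surj surj_f_inv_f bij_is_inj)
    have lu': "l $ i \<le> u $ i" for i using lu[of "axis i 1"] by (simp add: inner_axis axis_in_Basis_iff)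
    have eq: "?h -` box l u = box (\<chi> i. l $ ?q i) (\<chi> i. u $ ?q i)"
      by (auto simp: mem_box_cart) (metis q)+
    have BB: "(\<Prod>b\<in>Basis. (b1 - a1) \<bullet> b) = (\<Prod>i\<in>UNIV. b1 $ i - a1 $ i)" for a1 b1 :: "real^'d"
    proof -
      show ?thesis by (simp add: Basis_cart_eq_range prod.reindex[OF inj_axis] inner_axis)
    qed
    have "(\<Prod>i\<in>UNIV. u $ ?q i - l $ ?q i) = (\<Prod>i\<in>UNIV. u $ i - l $ i)"
      using p by (intro prod.reindex_bij_betw[of ?q]) (auto simp: bij_imp_bij_inv)
    moreover have "\<And>b. b \<in> Basis \<Longrightarrow> (\<chi> i. l $ ?q i) \<bullet> b \<le> (\<chi> i. u $ ?q i) \<bullet> b"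
      by (auto simp: Basis_vec_def inner_axis lu')
    ultimately show "emeasure (distr lborel borel ?h) (box l u) = (\<Prod>b\<in>Basis. (u - l) \<bullet> b)"
      by (subst emeasure_distr) (simp_all add: eq BB)
  qed simp
  then have "(\<integral>\<^sup>+x. G x \<partial>lborel) = (\<integral>\<^sup>+x. G x \<partial>distr lborel borel ?h)"
    by (rule arg_cong[where f = "\<lambda>M. integral\<^sup>N M G"])
  then show ?thesis by (simp add: nn_integral_distr)
qed

text \<open>Both sides are multiplicative under composition, so elementary maps suffice: maps with a
  vanishing coordinate (excluded by the determinant), diagonal maps, transpositions of coordinates
  and shears.\<close>

lemma nn_integral_lborel_linear:
  fixes f :: "real^'d \<Rightarrow> real^'d" and G :: "real^'d \<Rightarrow> ennreal"
  assumes "linear f" "det (matrix f) \<noteq> 0" "G \<in> borel_measurable borel"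
  shows "(\<integral>\<^sup>+x. G x \<partial>lborel) = ennreal \<bar>det (matrix f)\<bar> * (\<integral>\<^sup>+x. G (f x) \<partial>lborel)"
  using assms(2,3)
proof (induction arbitrary: G rule: induct_linear_elementary[OF assms(1)])
  case (1 f g)
  have [measurable]: "f \<in> borel_measurable borel" "g \<in> borel_measurable borel"
    using 1(1,2) by (auto intro!: borel_measurable_continuous_onI linear_continuous_on simp: linear_linear)
  have det: "det (matrix (f \<circ> g)) = det (matrix f) * det (matrix g)"
    using 1 by (simp add: matrix_compose det_mul)
  have [measurable]: "G \<in> borel_measurable borel" by fact
  have "det (matrix f) \<noteq> 0" "det (matrix g) \<noteq> 0" using 1(5) unfolding det by auto
  then show ?case
    using 1(3)[of G] 1(4)[of "\<lambda>x. G (f x)"]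
    unfolding det by (simp add: abs_mult ennreal_mult mult.assoc)
next
  case (2 f i)
  then have "row i (matrix f) = 0" by (simp add: row_def matrix_def vec_eq_iff)
  then show ?case using 2 by (simp add: det_zero_row)
next
  case (3 c)
  let ?h = "\<lambda>x::real^'d. \<chi> i. c i * x $ i"
  have m: "matrix ?h = (\<chi> i j. if i = j then c i else 0)"
    by (auto simp: matrix_def vec_eq_iff axis_def)
  have det: "det (matrix ?h) = prod c UNIV"
    unfolding m by (subst det_diagonal) auto
  have c: "c i \<noteq> 0" for i using 3(1) unfolding det by auto
  have [measurable]: "G \<in> borel_measurable borel" by fact
  \<comment> \<open>The diagonal entries, indexed by basis vectors instead of coordinates to match
    \<open>lborel_affine_euclidean\<close>.\<close>
  define C where "C = (\<lambda>b::real^'d. b \<bullet> (\<chi> i. c i))"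
  have Cp: "(\<Prod>j\<in>Basis. \<bar>C j\<bar>) = \<bar>prod c UNIV\<bar>"
    by (simp add: Basis_cart_eq_range prod.reindex[OF inj_axis] C_def inner_axis' abs_prod)
  have Cn: "C j \<noteq> 0" if "j \<in> Basis" for j
    using that c unfolding Basis_cart_eq_range by (auto simp: C_def inner_axis')
  have T: "0 + (\<Sum>j\<in>Basis. (C j * (x \<bullet> j)) *\<^sub>R j) = ?h x" for x
    unfolding Basis_cart_eq_range sum.reindex[OF inj_axis]
    by (simp add: C_def inner_axis inner_axis' vec_eq_iff) (simp add: axis_def if_distrib cong: if_cong)
  have "lborel = density (distr lborel borel ?h) (\<lambda>_. ennreal \<bar>prod c UNIV\<bar>)"
    by (rule lborel_affine_euclidean[of C 0, OF Cn, unfolded Cp T])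
  then have "(\<integral>\<^sup>+x. G x \<partial>lborel) = (\<integral>\<^sup>+x. G x \<partial>density (distr lborel borel ?h) (\<lambda>_. ennreal \<bar>prod c UNIV\<bar>))"
    by (rule arg_cong[where f = "\<lambda>M. integral\<^sup>N M G"])
  also have "\<dots> = ennreal \<bar>prod c UNIV\<bar> * (\<integral>\<^sup>+x. G (?h x) \<partial>lborel)"
  proof -
    have [measurable]: "?h \<in> borel_measurable borel"
      by (intro borel_measurable_continuous_onI continuous_intros)
    show ?thesis by (simp add: nn_integral_density nn_integral_distr nn_integral_cmult)
  qed
  finally show ?case by (simp add: det)
next
  case (4 m n)
  let ?p = "Transposition.transpose m n"
  let ?h = "\<lambda>x::real^'d. \<chi> i. x $ ?p i"
  have "matrix ?h = (\<chi> i. mat 1 $ ?p i)"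
    by (auto simp: matrix_def mat_def axis_def vec_eq_iff)
  then have "\<bar>det (matrix ?h)\<bar> = 1"
    by (simp add: det_permute_rows permutes_swap_id sign_swap_id abs_mult)
  then show ?case using nn_integral_lborel_permute[OF 4(3), of ?p] by simp
next
  case (5 m n)
  let ?h = "\<lambda>x::real^'d. \<chi> i. if i = m then x$m + x$n else x$i"
  have r: "row j (mat 1 :: real^'d^'d) = axis j 1" for j
    by (auto simp: row_def mat_def axis_def vec_eq_iff)
  have "matrix ?h = (\<chi> i. if i = m then axis m 1 + axis n 1 else axis i 1)"
    using 5(1) by (auto simp: matrix_def axis_def vec_eq_iff)
  \<comment> \<open>Row \<open>m\<close> is written as a combination of the rows of the identity, so
    that Cramer's rule gives the determinant as the coefficient of row \<open>m\<close>.\<close>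
  then have "matrix ?h = (\<chi> i. if i = m then (\<Sum>j\<in>UNIV. (axis m 1 + axis n 1)$j *s row j (mat 1)) else row i (mat 1))"
    unfolding r basis_expansion .
  then have "det (matrix ?h) = (axis m 1 + axis n 1 :: real^'d)$m * det (mat 1 :: real^'d^'d)"
    using cramer_lemma_transpose[of m "axis m 1 + axis n 1" "mat 1"] by simp
  then have "det (matrix ?h) = 1" using 5(1) by (simp add: axis_def)
  then show ?case using nn_integral_lborel_shear[OF 5(3,1)] by simp
qed

section \<open>Affine coordinates, parallelotopes and simplices\<close>

lemma linear_row_combination:
  fixes P :: "'d::finite \<Rightarrow> real^'d"
  shows "linear (\<lambda>z::real^'d. \<Sum>i\<in>UNIV. z$i *\<^sub>R P i)"
  by (intro linear_compose_sum ballI linearI) (auto simp: algebra_simps)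

lemma det_matrix_row_combination:
  fixes P :: "'d::finite \<Rightarrow> real^'d"
  shows "det (matrix (\<lambda>z::real^'d. \<Sum>i\<in>UNIV. z$i *\<^sub>R P i)) = det (\<chi> i. P i)"
proof -
  have "matrix (\<lambda>z::real^'d. \<Sum>i\<in>UNIV. z$i *\<^sub>R P i) = transpose (\<chi> i. P i)"
    by (auto simp: matrix_def transpose_def vec_eq_iff axis_def if_distrib if_distribR cong: if_cong)
  then show ?thesis by (simp add: det_transpose)
qed

lemma nn_integral_lborel_rows:
  fixes P :: "'d::finite \<Rightarrow> real^'d" and G :: "real^'d \<Rightarrow> ennreal"
  assumes det: "det (\<chi> i. P i) \<noteq> 0" and G [measurable]: "G \<in> borel_measurable borel"
  shows "(\<integral>\<^sup>+x. G x \<partial>lborel)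
    = ennreal \<bar>det (\<chi> i. P i)\<bar> * (\<integral>\<^sup>+z. G (p + (\<Sum>i\<in>UNIV. z$i *\<^sub>R P i)) \<partial>lborel)"
proof -
  let ?f = "\<lambda>z::real^'d. \<Sum>i\<in>UNIV. z$i *\<^sub>R P i"
  have lin: "linear ?f"
    by (rule linear_row_combination)
  have "(\<integral>\<^sup>+x. G x \<partial>lborel) = (\<integral>\<^sup>+x. G x \<partial>distr lborel borel ((+) p))"
    by (simp add: lborel_distr_plus)
  also have "\<dots> = (\<integral>\<^sup>+x. G (p + x) \<partial>lborel)"
    by (simp add: nn_integral_distr)
  also have "\<dots> = ennreal \<bar>det (matrix ?f)\<bar> * (\<integral>\<^sup>+z. G (p + ?f z) \<partial>lborel)"
    by (rule nn_integral_lborel_linear[OF lin, of "\<lambda>x. G (p + x)"]) (auto simp: det_matrix_row_combination det)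
  finally show ?thesis by (simp add: det_matrix_row_combination)
qed

text \<open>For a nonzero determinant, change variables in the integral of the indicator of the
  image. Otherwise the image lies in a proper affine subspace and both sides vanish. Compactness of
  \<open>S\<close> makes the image a Borel set.\<close>

lemma emeasure_lborel_rows_image:
  fixes P :: "'d::finite \<Rightarrow> real^'d" and S :: "(real^'d) set"
  assumes S: "compact S"
  shows "emeasure lborel ((\<lambda>z. p + (\<Sum>i\<in>UNIV. z$i *\<^sub>R P i)) ` S)
    = ennreal \<bar>det (\<chi> i. P i)\<bar> * emeasure lborel S"
proof -
  let ?f = "\<lambda>z::real^'d. \<Sum>i\<in>UNIV. z$i *\<^sub>R P i"
  let ?h = "\<lambda>z. p + ?f z"
  have lin: "linear ?f"
    by (rule linear_row_combination)
  have c: "compact (?h ` S)"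
    by (intro compact_continuous_image S continuous_intros)
  then have [measurable]: "?h ` S \<in> sets borel" "S \<in> sets borel" using S by (auto intro: borel_compact)
  show ?thesis
  proof (cases "det (\<chi> i. P i) = 0")
    case False
    then have "inj ?f"
      using det_nz_iff_inj[OF lin] by (simp add: det_matrix_row_combination)
    then have inj: "inj ?h" by (simp add: inj_def)
    have "emeasure lborel (?h ` S) = (\<integral>\<^sup>+x. indicator (?h ` S) x \<partial>lborel)" by simp
    also have "\<dots> = ennreal \<bar>det (\<chi> i. P i)\<bar> * (\<integral>\<^sup>+z. indicator (?h ` S) (?h z) \<partial>lborel)"
      by (rule nn_integral_lborel_rows[OF False]) simp
    also have "(\<lambda>z. indicator (?h ` S) (?h z) :: ennreal) = indicator S"
      by (simp add: indicator_def fun_eq_iff inj_image_mem_iff[OF inj])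
    finally show ?thesis by simp
  next
    case True
    then have "\<not> inj ?f"
      using det_nz_iff_inj[OF lin] by (simp add: det_matrix_row_combination)
    then have "negligible (?f ` S)" by (rule negligible_linear_singular_image[OF lin])
    then have "negligible ((+) p ` ?f ` S)" by (rule negligible_translation)
    then have "emeasure lebesgue (?h ` S) = 0"
      by (simp add: image_image negligible_iff_null_sets null_sets_def)
    then show ?thesis using True by simp
  qed
qed

text \<open>The simplex is the image of the standard simplex, whose volume is
  \<open>1 / fact CARD('d)\<close>, under the affine map sending the origin to \<open>x t\<close>
  and the unit vectors to the points \<open>x (g i)\<close>.\<close>

lemma emeasure_simplex:
  fixes x :: "'i \<Rightarrow> real^'d" and g :: "'d::finite \<Rightarrow> 'i"
  shows "emeasure lborel (convex hull (x ` insert t (range g)))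
    = ennreal (\<bar>det (\<chi> i. x (g i) - x t)\<bar> / fact CARD('d))"
proof -
  let ?P = "\<lambda>i. x (g i) - x t"
  let ?f = "\<lambda>z::real^'d. \<Sum>i\<in>UNIV. z$i *\<^sub>R ?P i"
  have lin: "linear ?f"
    by (rule linear_row_combination)
  have ax: "?f (axis i 1) = ?P i" for i
    by (simp add: axis_def if_distrib if_distribR cong: if_cong)
  have "x ` insert t (range g) = (+) (x t) ` ?f ` insert 0 Basis"
    by (auto simp: Basis_vec_def ax image_iff linear_0[OF lin])
  then have "convex hull (x ` insert t (range g)) = (\<lambda>z. x t + ?f z) ` (convex hull (insert 0 Basis))"
    by (simp only: convex_hull_translation convex_hull_linear_image[OF lin, symmetric])
       (simp only: image_image)
  moreover have "compact (convex hull (insert 0 Basis :: (real^'d) set))"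
    by (simp add: finite_imp_compact_convex_hull)
  ultimately show ?thesis
    by (simp add: emeasure_lborel_rows_image emeasure_std_simplex ennreal_mult[symmetric])
qed

lemma measure_simplex:
  fixes x :: "'i \<Rightarrow> real^'d" and g :: "'d::finite \<Rightarrow> 'i"
  shows "measure lborel (convex hull (x ` insert t (range g)))
    = \<bar>det (\<chi> i. x (g i) - x t)\<bar> / fact CARD('d)"
  unfolding measure_def emeasure_simplex by simp

text \<open>A point outside a compact convex set is strictly separated from it, and the vectors
  separating a point from finitely many others form an open set. So the separating vector may be
  taken from a countable dense set, and the event becomes a countable union of finite
  intersections.\<close>

lemma measurable_notin_convex_hull:
  fixes X :: "'i \<Rightarrow> 'w \<Rightarrow> 'a::euclidean_space"
  assumes J: "finite J" and X: "\<And>i. i \<in> insert j J \<Longrightarrow> X i \<in> borel_measurable M"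
  shows "Measurable.pred M (\<lambda>\<omega>. X j \<omega> \<notin> convex hull ((\<lambda>i. X i \<omega>) ` J))"
proof -
  obtain D :: "'a set" where D: "countable D" "\<And>U. open U \<Longrightarrow> U \<noteq> {} \<Longrightarrow> \<exists>d\<in>D. d \<in> U"
    by (rule countable_dense_setE) blast
  have eq: "q \<notin> convex hull (y ` J) \<longleftrightarrow> (\<exists>a\<in>D. \<forall>i\<in>J. a \<bullet> q < a \<bullet> y i)" for q and y :: "'i \<Rightarrow> 'a"
  proof
    assume "q \<notin> convex hull (y ` J)"
    moreover have "closed (convex hull (y ` J))"
      using J by (simp add: finite_imp_compact_convex_hull compact_imp_closed)
    ultimately obtain a b where ab: "a \<bullet> q < b" "\<forall>z\<in>convex hull (y ` J). b < a \<bullet> z"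
      using separating_hyperplane_closed_point[of "convex hull (y ` J)" q] by auto
    define U where "U = {a. \<forall>i\<in>J. a \<bullet> q < a \<bullet> y i}"
    have "U = (\<Inter>i\<in>J. {a. a \<bullet> q < a \<bullet> y i})" by (auto simp: U_def)
    moreover have "open {a. a \<bullet> q < a \<bullet> y i}" for i
      by (intro open_Collect_less continuous_intros)
    ultimately have "open U" using J by auto
    moreover have "a \<in> U"
      unfolding U_def using ab by (auto intro!: less_trans[OF ab(1)] hull_inc)
    ultimately show "\<exists>a\<in>D. \<forall>i\<in>J. a \<bullet> q < a \<bullet> y i"
      using D(2)[of U] by (auto simp: U_def)
  next
    assume "\<exists>a\<in>D. \<forall>i\<in>J. a \<bullet> q < a \<bullet> y i"
    then obtain a where a: "\<And>i. i \<in> J \<Longrightarrow> a \<bullet> q < a \<bullet> y i" by blast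
    have "convex hull (y ` J) \<subseteq> {z. a \<bullet> q < a \<bullet> z}"
      using a by (intro hull_minimal) (auto simp: convex_halfspace_gt)
    then show "q \<notin> convex hull (y ` J)" by auto
  qed
  have [measurable]: "X j \<in> borel_measurable M" using X by auto
  have "Measurable.pred M (\<lambda>\<omega>. \<exists>a\<in>D. \<forall>i\<in>J. a \<bullet> X j \<omega> < a \<bullet> X i \<omega>)"
    unfolding pred_def
  proof (rule sets.sets_Collect_countable_Ex'[OF _ D(1)], fold pred_def, rule pred_intros_finite(3)[OF J])
    fix a i assume "i \<in> J"
    then have [measurable]: "X i \<in> borel_measurable M" using X by auto
    show "Measurable.pred M (\<lambda>\<omega>. a \<bullet> X j \<omega> < a \<bullet> X i \<omega>)" by measurable
  qed
  then show ?thesis by (simp add: eq)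
qed

section \<open>The density of the volume of a random simplex\<close>

text \<open>
  By Cramer's rule the coefficient of \<open>w i\<close> in \<open>e\<close> is proportional to the determinant with row \<open>i\<close>
  replaced by \<open>e\<close>. If \<open>w\<close> lists the edges at a vertex, the last condition says that the coefficient
  of that vertex divided by the one of \<open>w r\<close> is at least \<open>-1\<close>.
\<close>

definition dominant_row :: "('d::finite \<Rightarrow> real^'d) \<Rightarrow> real^'d \<Rightarrow> 'd \<Rightarrow> bool" where
  "dominant_row w e r \<longleftrightarrow>
     det (\<chi> j. if j = r then e else w j) \<noteq> 0 \<and>
     (\<forall>i. \<bar>det (\<chi> j. if j = i then e else w j)\<bar> \<le> \<bar>det (\<chi> j. if j = r then e else w j)\<bar>) \<and>
     (\<Sum>i\<in>UNIV - {r}. det (\<chi> j. if j = i then e else w j) / det (\<chi> j. if j = r then e else w j)) \<le> 0"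

section \<open>Cramer's rule and the dominant vertex\<close>

lemma det_replace_row_combination:
  fixes w :: "'d::finite \<Rightarrow> real^'d"
  shows "det (\<chi> j. if j = i then (\<Sum>l\<in>UNIV. a l *\<^sub>R w l) else w j) = a i * det (\<chi> j. w j)"
proof -
  have "row l (\<chi> j. w j) = w l" for l by (simp add: row_def vec_lambda_eta)
  then show ?thesis
    using cramer_lemma_transpose[of i "\<chi> l. a l" "\<chi> j. w j"]
    by (simp only: scalar_mult_eq_scaleR vec_lambda_beta)
qed

lemma det_nonzero_imp_combination:
  fixes w :: "'d::finite \<Rightarrow> real^'d"
  assumes "det (\<chi> j. w j) \<noteq> 0"
  obtains a where "e = (\<Sum>l\<in>UNIV. a l *\<^sub>R w l)"
proof -
  let ?f = "\<lambda>z::real^'d. \<Sum>i\<in>UNIV. z$i *\<^sub>R w i"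
  have lin: "linear ?f"
    by (rule linear_row_combination)
  have "inj ?f" using det_nz_iff_inj[OF lin] assms by (simp add: det_matrix_row_combination)
  then have "surj ?f" using linear_injective_imp_surjective[OF lin] by blast
  then obtain z where z: "e = ?f z" by (rule surjE)
  show thesis by (rule that[OF z])
qed

text \<open>Write \<open>e\<close> as a combination of the vertices with coefficients of sum zero.
  The coefficients do not depend on the enumeration of the vertices, and \<open>s\<close> is a
  vertex whose coefficient is largest in absolute value. The quantification over all enumerations
  with \<open>s\<close> at position \<open>r\<close> allows one enumeration per vertex to be fixed
  before \<open>x\<close> is known.\<close>

lemma exists_dominant_vertex:
  fixes x :: "'i \<Rightarrow> real^'d::finite" and g :: "'d \<Rightarrow> 'i"
  assumes det: "det (\<chi> i. x (g i) - x t) \<noteq> 0" and e: "e \<noteq> 0"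
    and g: "inj g" "t \<notin> range g"
  obtains s where "s \<in> insert t (range g)"
    "\<And>g' t'. inj g' \<Longrightarrow> t' \<notin> range g' \<Longrightarrow> insert t' (range g') = insert t (range g) \<Longrightarrow> g' r = s
       \<Longrightarrow> dominant_row (\<lambda>i. x (g' i) - x t') e r"
proof -
  define T where "T = insert t (range g)"
  have finT: "finite T" by (simp add: T_def)
  obtain a where a: "e = (\<Sum>l\<in>UNIV. a l *\<^sub>R (x (g l) - x t))"
    using det_nonzero_imp_combination[OF det] by blast
  \<comment> \<open>Each edge ends in the base vertex \<open>t\<close> with a minus sign, so
    \<open>t\<close> receives the negated sum of the edge coefficients.\<close>
  define \<beta> where "\<beta> j = (if j = t then - sum a UNIV else a (inv g j))" for j
  have \<beta>g: "\<beta> (g i) = a i" for i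
    using g by (auto simp: \<beta>_def inv_f_f)
  have sumT: "(\<Sum>j\<in>T. h j) = h t' + (\<Sum>i\<in>UNIV. h (g' i))"
    if "inj g'" "t' \<notin> range g'" "insert t' (range g') = T" for g' :: "'d \<Rightarrow> 'i" and t' and h :: "'i \<Rightarrow> 'b::comm_monoid_add"
  proof -
    have "(\<Sum>j\<in>T. h j) = h t' + (\<Sum>j\<in>range g'. h j)"
      using that(2) by (simp flip: that(3))
    then show ?thesis using that(1) by (simp add: sum.reindex)
  qed
  have \<beta>0: "(\<Sum>j\<in>T. \<beta> j) = 0"
    using sumT[OF g, of \<beta>] by (simp add: T_def \<beta>g) (simp add: \<beta>_def)
  have \<beta>e: "(\<Sum>j\<in>T. \<beta> j *\<^sub>R x j) = e"
    using sumT[OF g, of "\<lambda>j. \<beta> j *\<^sub>R x j"]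
    by (simp add: T_def \<beta>g a scaleR_diff_right sum_subtractf scaleR_left.sum) (simp add: \<beta>_def scaleR_left.sum)
  \<comment> \<open>As the coefficients sum to zero, any vertex \<open>t'\<close> can serve as base,
    with unchanged coefficients on the other vertices.\<close>
  have comb: "e = (\<Sum>i\<in>UNIV. \<beta> (g' i) *\<^sub>R (x (g' i) - x t'))"
    if "inj g'" "t' \<notin> range g'" "insert t' (range g') = T" for g' :: "'d \<Rightarrow> 'i" and t'
  proof -
    have "\<beta> t' = - (\<Sum>i\<in>UNIV. \<beta> (g' i))" using sumT[OF that, of \<beta>] \<beta>0 by simp
    moreover have "e = \<beta> t' *\<^sub>R x t' + (\<Sum>i\<in>UNIV. \<beta> (g' i) *\<^sub>R x (g' i))"
      using sumT[OF that, of "\<lambda>j. \<beta> j *\<^sub>R x j"] \<beta>e by simp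
    ultimately show ?thesis
      by (simp add: scaleR_diff_right sum_subtractf scaleR_left.sum)
  qed
  have "T \<noteq> {}" by (auto simp: T_def)
  have "\<exists>s\<in>T. \<forall>j\<in>T. \<bar>\<beta> j\<bar> \<le> \<bar>\<beta> s\<bar>"
  proof -
    have "Max ((\<lambda>j. \<bar>\<beta> j\<bar>) ` T) \<in> (\<lambda>j. \<bar>\<beta> j\<bar>) ` T" using finT \<open>T \<noteq> {}\<close> by (intro Max_in) auto
    then obtain s where "s \<in> T" "Max ((\<lambda>j. \<bar>\<beta> j\<bar>) ` T) = \<bar>\<beta> s\<bar>" by blast
    then show ?thesis using finT by (metis Max_ge finite_imageI imageI)
  qed
  then obtain s where s: "s \<in> T" "\<And>j. j \<in> T \<Longrightarrow> \<bar>\<beta> j\<bar> \<le> \<bar>\<beta> s\<bar>" by blast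
  have \<beta>s: "\<beta> s \<noteq> 0"
  proof
    assume "\<beta> s = 0"
    then have "\<beta> j = 0" if "j \<in> T" for j using s(2)[OF that] by simp
    then show False using \<beta>e e by simp
  qed
  show thesis
  proof (rule that)
    show "s \<in> insert t (range g)" using s by (simp add: T_def)
    fix g' :: "'d \<Rightarrow> 'i" and t'
    assume g': "inj g'" "t' \<notin> range g'" and T': "insert t' (range g') = insert t (range g)" and r: "g' r = s"
    note T' = T'[folded T_def]
    let ?w = "\<lambda>i. x (g' i) - x t'"
    let ?D = "det (\<chi> i. ?w i)"
    \<comment> \<open>Both determinants measure the same simplex, whose volume does not depend on
      the enumeration.\<close>
    have "\<bar>?D\<bar> = \<bar>det (\<chi> i. x (g i) - x t)\<bar>"
      using measure_simplex[of x t' g'] measure_simplex[of x t g] T' by (simp add: T_def)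
    then have D: "?D \<noteq> 0" using det by auto
    have \<delta>: "det (\<chi> j. if j = i then e else ?w j) = \<beta> (g' i) * ?D" for i
      using det_replace_row_combination[of i "\<lambda>l. \<beta> (g' l)" ?w]
      by (simp only: comb[OF g' T', symmetric])
    have in_T: "g' i \<in> T" "t' \<in> T" for i using T' by auto
    \<comment> \<open>The coefficients other than those of \<open>s\<close> and \<open>t'\<close>
      sum to \<open>- \<beta> t' - \<beta> s\<close>. Divided by \<open>\<beta> s\<close> this is at
      most zero, because \<open>\<beta> s\<close> is largest in absolute value.\<close>
    have "(\<Sum>i\<in>UNIV - {r}. \<beta> (g' i) * ?D / (\<beta> s * ?D)) = (\<Sum>i\<in>UNIV - {r}. \<beta> (g' i)) / \<beta> s"
      using D by (simp add: sum_divide_distrib)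
    also have "(\<Sum>i\<in>UNIV - {r}. \<beta> (g' i)) = (\<Sum>i\<in>UNIV. \<beta> (g' i)) - \<beta> s"
      by (subst sum_diff1) (auto simp: r)
    also have "(\<Sum>i\<in>UNIV. \<beta> (g' i)) = - \<beta> t'"
      using sumT[OF g' T', of \<beta>] \<beta>0 by simp
    also have "(- \<beta> t' - \<beta> s) / \<beta> s = - (\<beta> t' / \<beta> s) - 1"
      using \<beta>s by (simp add: field_simps)
    also have "\<dots> \<le> 0"
    proof -
      have "\<bar>\<beta> t' / \<beta> s\<bar> \<le> 1" using s(2)[OF in_T(2)] \<beta>s by (simp add: abs_divide)
      then show ?thesis by linarith
    qed
    finally show "dominant_row ?w e r"
      unfolding dominant_row_def \<delta> using D \<beta>s s(2)[OF in_T(1)]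
      by (auto simp: r abs_mult intro: mult_right_mono)
  qed
qed

text \<open>The reflection \<open>z \<mapsto> - z\<close> preserves the integrand and swaps the two
  signs of the coordinate sum, and sum zero has measure zero. So twice the integral over one half is
  the integral over both. The latter is a product of one-dimensional integrals in which each
  coordinate other than \<open>r\<close> contributes the length 2.\<close>

lemma nn_integral_half_cube:
  fixes F :: "real \<Rightarrow> real" and r :: "'d::finite"
  assumes F [measurable]: "F \<in> borel_measurable borel" and F0: "\<And>v. 0 \<le> F v"
    and d: "2 \<le> CARD('d)"
  shows "2 * (\<integral>\<^sup>+z. ennreal (F \<bar>z$r\<bar>) * indicator {z. (\<forall>i. i \<noteq> r \<longrightarrow> \<bar>z$i\<bar> \<le> 1) \<and> 0 \<le> (\<Sum>i\<in>UNIV - {r}. z$i)} (z::real^'d) \<partial>lborel)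
    = 2 ^ (CARD('d) - 1) * (\<integral>\<^sup>+v. ennreal (F \<bar>v\<bar>) \<partial>lborel)"
proof -
  define C where "C = {z::real^'d. \<forall>i. i \<noteq> r \<longrightarrow> \<bar>z$i\<bar> \<le> 1}"
  define S where "S = (\<lambda>z::real^'d. \<Sum>i\<in>UNIV - {r}. z$i)"
  define Q where "Q = (\<lambda>z::real^'d. ennreal (F \<bar>z$r\<bar>) * indicator C z)"
  have "closed C" unfolding C_def
    by (intro closed_Collect_all closed_Collect_imp closed_Collect_le continuous_intros open_Collect_const)
  then have [measurable]: "C \<in> sets borel" by simp
  have [measurable]: "Q \<in> borel_measurable borel" unfolding Q_def by measurable
  have [measurable]: "S \<in> borel_measurable borel" unfolding S_def by measurable
  have Qm: "Q (- z) = Q z" "S (- z) = - S z" for z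
    by (auto simp: Q_def C_def S_def sum_negf indicator_def)
  let ?I = "\<integral>\<^sup>+z. Q z * indicator {z. 0 \<le> S z} z \<partial>lborel"
  have I2: "?I = (\<integral>\<^sup>+z. Q z * indicator {z. S z \<le> 0} z \<partial>lborel)"
  proof -
    have "lborel = density (distr lborel borel (\<lambda>x::real^'d. 0 + (-1) *\<^sub>R x)) (\<lambda>_. ennreal (\<bar>-1\<bar> ^ DIM(real^'d)))"
      by (rule lborel_affine) simp
    then have "?I = (\<integral>\<^sup>+z. Q z * indicator {z. 0 \<le> S z} z \<partial>density (distr lborel borel (\<lambda>x::real^'d. 0 + (-1) *\<^sub>R x)) (\<lambda>_. ennreal (\<bar>-1\<bar> ^ DIM(real^'d))))"
      by (rule arg_cong[where f = "\<lambda>M. nn_integral M _"])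
    also have "\<dots> = (\<integral>\<^sup>+z. Q (- z) * indicator {z. 0 \<le> S z} (- z) \<partial>lborel)"
      by (simp add: nn_integral_density nn_integral_distr)
    also have "\<dots> = (\<integral>\<^sup>+z. Q z * indicator {z. S z \<le> 0} z \<partial>lborel)"
      by (intro nn_integral_cong) (auto simp: Qm indicator_def)
    finally show ?thesis .
  qed
  have "card (UNIV - {r}) \<noteq> 0" using d by simp
  \<comment> \<open>A second coordinate makes \<open>S\<close> a nonzero linear form, so that its
    zero set is a hyperplane. This uses dimension at least two.\<close>
  then obtain i0 where i0: "i0 \<noteq> r" by (metis DiffE card.empty ex_in_conv insertI1 singleton_iff)
  have "AE z in lborel. S z \<noteq> 0"
  proof -
    define c where "c = (\<chi> i. if i = r then 0 else (1::real))"
    have Sc: "S z = c \<bullet> z" for z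
      unfolding S_def c_def inner_vec_def by (intro sum.mono_neutral_cong_left) auto
    have "c $ i0 \<noteq> 0" using i0 by (simp add: c_def)
    then have "c \<noteq> 0" by (metis zero_index)
    then have "negligible {z. c \<bullet> z = 0}" by (intro negligible_hyperplane) auto
    then have "{z. S z = 0} \<in> null_sets lebesgue" by (simp add: Sc negligible_iff_null_sets)
    then have "AE z in lebesgue. S z \<noteq> 0" by (intro AE_I'[of "{z. S z = 0}"]) auto
    then show ?thesis by (simp add: AE_completion_iff)
  qed
  then have Qsum: "(\<integral>\<^sup>+z. Q z \<partial>lborel) = (\<integral>\<^sup>+z. Q z * indicator {z. 0 \<le> S z} z + Q z * indicator {z. S z \<le> 0} z \<partial>lborel)"
    by (intro nn_integral_cong_AE) (auto simp: indicator_def)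
  also have "\<dots> = 2 * ?I"
    by (subst nn_integral_add) (auto simp: I2 mult_2)
  finally have 2: "2 * ?I = (\<integral>\<^sup>+z. Q z \<partial>lborel)" ..
  define f :: "real^'d \<Rightarrow> real \<Rightarrow> ennreal"
    where "f b = (if b = axis r 1 then (\<lambda>s. ennreal (F \<bar>s\<bar>)) else indicator {-1..1})" for b
  have prodB: "(\<Prod>b\<in>Basis. h b) = h (axis r 1) * (\<Prod>i\<in>UNIV-{r}. h (axis i 1))" for h :: "real^'d \<Rightarrow> ennreal"
    by (simp add: Basis_cart_eq_range prod.reindex[OF inj_axis] prod.remove[of _ r])
  have fr: "f (axis r 1) = (\<lambda>s. ennreal (F \<bar>s\<bar>))" by (simp add: f_def)
  have fi: "f (axis i 1) = indicator {-1..1}" if "i \<in> UNIV - {r}" for i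
    using that by (simp add: f_def axis_eq_axis)
  have Qp: "Q z = (\<Prod>b\<in>Basis. f b (z \<bullet> b))" for z
  proof -
    have "(\<Prod>i\<in>UNIV-{r}. f (axis i 1) (z$i)) = (\<Prod>i\<in>UNIV-{r}. indicator {-1..1} (z$i))"
      by (intro prod.cong) (simp_all add: fi)
    also have "\<dots> = indicator C z"
      by (cases "z \<in> C") (auto simp: C_def indicator_def abs_le_iff intro!: prod.neutral)
    finally show ?thesis
      unfolding prodB Q_def by (simp add: fr inner_axis)
  qed
  have "(\<integral>\<^sup>+z. Q z \<partial>lborel) = (\<Prod>b\<in>Basis. \<integral>\<^sup>+s. f b s \<partial>lborel)"
    unfolding Qp by (rule nn_integral_lborel_prod) (auto simp: f_def)
  also have "\<dots> = (\<integral>\<^sup>+v. ennreal (F \<bar>v\<bar>) \<partial>lborel) * (\<Prod>i\<in>UNIV-{r}. \<integral>\<^sup>+s. f (axis i 1) s \<partial>lborel)"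
    unfolding prodB fr ..
  also have "(\<Prod>i\<in>UNIV-{r}. \<integral>\<^sup>+s. f (axis i 1) s \<partial>lborel) = (\<Prod>i\<in>UNIV-{r}. 2)"
    by (intro prod.cong refl) (simp add: fi)
  also have "\<dots> = 2 ^ (CARD('d) - 1)" by simp
  finally have Q: "(\<integral>\<^sup>+z. Q z \<partial>lborel) = 2 ^ (CARD('d) - 1) * (\<integral>\<^sup>+v. ennreal (F \<bar>v\<bar>) \<partial>lborel)"
    by (simp add: mult.commute)
  have I: "?I = (\<integral>\<^sup>+z. ennreal (F \<bar>z$r\<bar>) * indicator {z. (\<forall>i. i \<noteq> r \<longrightarrow> \<bar>z$i\<bar> \<le> 1) \<and> 0 \<le> (\<Sum>i\<in>UNIV - {r}. z$i)} z \<partial>lborel)"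
    by (intro nn_integral_cong) (auto simp: Q_def C_def S_def indicator_def)
  show ?thesis unfolding I[symmetric] 2 Q ..
qed

section \<open>Measurability of determinants and of dominance\<close>

lemma borel_measurable_det [measurable (raw)]:
  fixes W :: "'d::finite \<Rightarrow> 'a \<Rightarrow> real^'d"
  assumes [measurable]: "\<And>i. W i \<in> borel_measurable M"
  shows "(\<lambda>x. det (\<chi> i. W i x)) \<in> borel_measurable M"
proof -
  have [measurable]: "(\<lambda>x. W i x $ k) \<in> borel_measurable M" for i k
    by (rule measurable_compose[OF assms])
       (auto intro!: borel_measurable_continuous_onI continuous_intros)
  show ?thesis unfolding det_def vec_lambda_beta
    by (intro borel_measurable_sum borel_measurable_times borel_measurable_prod) auto
qed

lemma measurable_dominant_row:
  fixes W :: "'d::finite \<Rightarrow> 'a \<Rightarrow> real^'d"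
  assumes [measurable]: "\<And>i. W i \<in> borel_measurable M"
  shows "Measurable.pred M (\<lambda>x. dominant_row (\<lambda>i. W i x) e r)"
proof -
  have [measurable]: "(\<lambda>x. det (\<chi> j. if j = i then e else W j x)) \<in> borel_measurable M" for i
    by (rule borel_measurable_det) simp
  show ?thesis unfolding dominant_row_def by measurable
qed

text \<open>Use coordinates \<open>z\<close> with origin \<open>p\<close> and basis
  \<open>P\<close>, which is \<open>w\<close> with \<open>e\<close> in place \<open>r\<close>. Then
  the simplex has volume \<open>c * \<bar>z$r\<bar>\<close>, and dominance of row \<open>r\<close>
  says that the other coordinates lie in \<open>[-1, 1]\<close> and have a nonnegative sum. The
  Jacobian is \<open>fact CARD('d) * c\<close>, and rescaling \<open>z$r\<close> by \<open>c\<close>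
  removes the factor \<open>c\<close>. Thus the bound depends on neither \<open>w\<close>,
  \<open>p\<close> nor \<open>e\<close>.\<close>

lemma nn_integral_dominant_fibre:
  fixes F :: "real \<Rightarrow> real" and w :: "'d::finite \<Rightarrow> real^'d"
  assumes F [measurable]: "F \<in> borel_measurable borel" and F0: "\<And>v. 0 \<le> F v"
    and d: "2 \<le> CARD('d)"
  shows "2 * (\<integral>\<^sup>+q. ennreal (F (\<bar>det (\<chi> i. (w(r := q - p)) i)\<bar> / fact CARD('d)))
      * indicator {q. det (\<chi> i. (w(r := q - p)) i) \<noteq> 0 \<and> dominant_row (w(r := q - p)) e r} q \<partial>lborel)
    \<le> 2 ^ (CARD('d) - 1) * fact CARD('d) * (\<integral>\<^sup>+v. ennreal (F \<bar>v\<bar>) \<partial>lborel)"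
proof -
  let ?w = "\<lambda>q. w(r := q - p)"
  define P where "P = w(r := e)"
  define b where "b = det (\<chi> i. P i)"
  define A where "A = {q. det (\<chi> i. ?w q i) \<noteq> 0 \<and> dominant_row (?w q) e r}"
  define H where "H = (\<lambda>q. ennreal (F (\<bar>det (\<chi> i. ?w q i)\<bar> / fact CARD('d))) * indicator A q)"
  have \<delta>r: "(\<lambda>j. if j = r then e else ?w q j) = P" for q by (auto simp: P_def)
  have [measurable]: "(\<lambda>q. ?w q i) \<in> borel_measurable borel" for i by (cases "i = r") auto
  have [measurable]: "Measurable.pred borel (\<lambda>q. dominant_row (?w q) e r)"
    using measurable_dominant_row[of "\<lambda>i q. ?w q i" borel e r] by (simp add: fun_upd_def)
  have [measurable]: "H \<in> borel_measurable borel" unfolding H_def A_def by measurable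
  show ?thesis
  proof (cases "b = 0")
    case True
    \<comment> \<open>Putting \<open>e\<close> in row \<open>r\<close> removes \<open>q\<close> from
      the matrix, so the determinant condition of dominance fails for all \<open>q\<close> at
      once.\<close>
    then have "\<not> dominant_row (?w q) e r" for q
      unfolding dominant_row_def \<delta>r b_def by simp
    then have "H = (\<lambda>q. 0)" by (simp add: H_def A_def)
    then show ?thesis unfolding A_def[symmetric] H_def[symmetric] by simp
  next
    case False
    let ?h = "\<lambda>z::real^'d. p + (\<Sum>i\<in>UNIV. z$i *\<^sub>R P i)"
    let ?R = "{z::real^'d. (\<forall>i. i \<noteq> r \<longrightarrow> \<bar>z$i\<bar> \<le> 1) \<and> 0 \<le> (\<Sum>i\<in>UNIV - {r}. z$i)}"
    define c where "c = \<bar>b\<bar> / fact CARD('d)"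
    have c: "c > 0" using False by (simp add: c_def)
    have le: "H (?h z) \<le> ennreal (F (c * \<bar>z$r\<bar>)) * indicator ?R z" for z
    proof -
      let ?q = "?h z"
      have w': "?w ?q j = (if j = r then (\<Sum>i\<in>UNIV. z$i *\<^sub>R P i) else P j)" for j
        by (simp add: P_def)
      have D: "det (\<chi> i. ?w ?q i) = z$r * b"
        unfolding w' b_def by (rule det_replace_row_combination)
      show ?thesis
      proof (cases "z$r * b \<noteq> 0 \<and> dominant_row (?w ?q) e r")
        case True
        then have zr: "z$r \<noteq> 0" and dom: "dominant_row (?w ?q) e r" by auto
        have \<delta>: "det (\<chi> j. if j = i then e else ?w ?q j) = - z$i * b" if "i \<noteq> r" for i
        proof -
          \<comment> \<open>The coefficients come from solving the coordinate equation of
            \<open>q - p\<close> for its basis vector \<open>P r\<close>, which is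
            \<open>e\<close>.\<close>
          define y where "y l = (if l = r then 1 / z$r else - z$l / z$r)" for l
          have split: "(\<Sum>l\<in>UNIV. u l) = u r + (\<Sum>l\<in>UNIV-{r}. u l)" for u :: "'d \<Rightarrow> real^'d"
            by (simp add: sum.remove)
          have "(\<Sum>l\<in>UNIV. y l *\<^sub>R ?w ?q l)
              = (1 / z$r) *\<^sub>R (\<Sum>l\<in>UNIV. z$l *\<^sub>R P l) + (\<Sum>l\<in>UNIV-{r}. (- z$l / z$r) *\<^sub>R P l)"
            unfolding w' split[of "\<lambda>l. y l *\<^sub>R _ l"] by (simp add: y_def)
          also have "\<dots> = e"
            unfolding split using zr
            by (simp add: scaleR_add_right scaleR_sum_right sum_negf) (simp add: P_def)
          finally have e: "e = (\<Sum>l\<in>UNIV. y l *\<^sub>R ?w ?q l)" ..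
          have "det (\<chi> j. if j = i then e else ?w ?q j) = y i * det (\<chi> j. ?w ?q j)"
            by (subst e) (rule det_replace_row_combination)
          then show ?thesis unfolding D using zr that by (simp add: y_def)
        qed
        have br: "det (\<chi> j. if j = r then e else ?w ?q j) = b" unfolding \<delta>r b_def ..
        have dom1: "\<bar>det (\<chi> j. if j = i then e else ?w ?q j)\<bar> \<le> \<bar>b\<bar>" for i
          using dom unfolding dominant_row_def br by blast
        have dom2: "(\<Sum>i\<in>UNIV - {r}. det (\<chi> j. if j = i then e else ?w ?q j) / b) \<le> 0"
          using dom unfolding dominant_row_def br by blast
        \<comment> \<open>The determinant quotients are \<open>- z$i\<close>, so the two remaining
          conditions of dominance become the two conditions of \<open>?R\<close>.\<close>
        have "\<bar>z$i\<bar> \<le> 1" if "i \<noteq> r" for i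
        proof -
          have "\<bar>- z$i * b\<bar> \<le> \<bar>b\<bar>" using dom1[of i] unfolding \<delta>[OF that] .
          then show ?thesis using False by (simp add: abs_mult)
        qed
        moreover have "0 \<le> (\<Sum>i\<in>UNIV - {r}. z$i)"
        proof -
          have "(\<Sum>i\<in>UNIV - {r}. det (\<chi> j. if j = i then e else ?w ?q j) / b) = (\<Sum>i\<in>UNIV - {r}. - z$i)"
          proof (rule sum.cong[OF refl])
            fix i assume "i \<in> UNIV - {r}"
            then have "i \<noteq> r" by simp
            show "det (\<chi> j. if j = i then e else ?w ?q j) / b = - z$i"
              unfolding \<delta>[OF \<open>i \<noteq> r\<close>] using False by simp
          qed
          with dom2 show ?thesis by (simp only: sum_negf neg_le_0_iff_le)
        qed
        ultimately have "z \<in> ?R" by simp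
        then show ?thesis
          unfolding H_def A_def D by (simp add: c_def abs_mult mult.commute indicator_def)
      next
        case False
        then have "?q \<notin> A"
          unfolding A_def mem_Collect_eq D by blast
        then have "H ?q = 0" by (simp add: H_def)
        then show ?thesis by simp
      qed
    qed
    have "2 * (\<integral>\<^sup>+q. H q \<partial>lborel) = ennreal \<bar>b\<bar> * (2 * (\<integral>\<^sup>+z. H (?h z) \<partial>lborel))"
      using nn_integral_lborel_rows[of P H p] False unfolding b_def by (simp add: mult.left_commute)
    also have "\<dots> \<le> ennreal \<bar>b\<bar> * (2 * (\<integral>\<^sup>+z. ennreal (F (c * \<bar>z$r\<bar>)) * indicator ?R z \<partial>lborel))"
      by (intro mult_left_mono nn_integral_mono le) auto
    also have "\<dots> = ennreal \<bar>b\<bar> * (2 ^ (CARD('d) - 1) * (\<integral>\<^sup>+v. ennreal (F (c * \<bar>v\<bar>)) \<partial>lborel))"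
      by (subst nn_integral_half_cube[of "\<lambda>v. F (c * v)", OF _ F0 d]) auto
    also have "\<dots> = 2 ^ (CARD('d) - 1) * fact CARD('d) * (ennreal c * (\<integral>\<^sup>+v. ennreal (F (c * \<bar>v\<bar>)) \<partial>lborel))"
    proof -
      have "ennreal \<bar>b\<bar> = ennreal (fact CARD('d) * c)" by (simp add: c_def)
      also have "\<dots> = fact CARD('d) * ennreal c"
        using c by (simp add: ennreal_mult ennreal_fact)
      finally show ?thesis by (simp add: mult_ac)
    qed
    also have "ennreal c * (\<integral>\<^sup>+v. ennreal (F (c * \<bar>v\<bar>)) \<partial>lborel) = (\<integral>\<^sup>+v. ennreal (F \<bar>v\<bar>) \<partial>lborel)"
      using nn_integral_real_affine[of "\<lambda>v. ennreal (F \<bar>v\<bar>)" c 0] c by (simp add: abs_mult)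
    finally show ?thesis unfolding H_def A_def .
  qed
qed

section \<open>The uniform distribution on a convex body of volume one\<close>

locale unit_volume_body =
  fixes K :: "(real^'d::finite) set"
  assumes compact_K: "compact K" and convex_K: "convex K"
    and emeasure_K: "emeasure lborel K = 1"
begin

definition U :: "(real^'d) measure" where "U = uniform_measure lborel K"

lemma K_borel [measurable, simp]: "K \<in> sets borel"
  using compact_K by (rule borel_compact)

lemma sets_U [simp, measurable_cong]: "sets U = sets borel"
  by (simp add: U_def)

lemma space_U [simp]: "space U = UNIV"
  by (simp add: U_def)

lemma emeasure_U: "A \<in> sets borel \<Longrightarrow> emeasure U A = emeasure lborel (K \<inter> A)"
  by (simp add: U_def emeasure_K divide_ennreal_def)

lemma prob_space_U: "prob_space U"
  unfolding U_def by (rule prob_space_uniform_measure) (simp_all add: emeasure_K)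

text \<open>The density of \<open>U\<close> is the indicator of \<open>K\<close>, because
  \<open>K\<close> has volume one. Letting a point range over the whole space instead of
  \<open>K\<close> is what makes the later bounds independent of the body.\<close>

lemma nn_integral_U_le:
  assumes [measurable]: "f \<in> borel_measurable borel"
  shows "(\<integral>\<^sup>+x. f x \<partial>U) \<le> (\<integral>\<^sup>+x. f x \<partial>lborel)"
proof -
  have "(\<integral>\<^sup>+x. f x \<partial>U) = (\<integral>\<^sup>+x. f x * indicator K x \<partial>lborel)"
    unfolding U_def by (subst nn_integral_uniform_measure) (simp_all add: emeasure_K divide_ennreal_def)
  also have "\<dots> \<le> (\<integral>\<^sup>+x. f x \<partial>lborel)"
    by (intro nn_integral_mono) (auto simp: indicator_def)
  finally show ?thesis .
qed

lemma negligible_imp_AE_U: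
  assumes "negligible N" shows "AE x in U. x \<notin> N"
proof -
  have "AE x in lebesgue. x \<notin> N"
    using assms by (intro AE_I'[of N]) (auto simp: negligible_iff_null_sets)
  then have "AE x in lborel. x \<notin> N" by (simp add: AE_completion_iff)
  then have "AE x in density lborel (\<lambda>x. indicator K x / emeasure lborel K). x \<notin> N"
    by (subst AE_density) auto
  then show ?thesis unfolding U_def uniform_measure_def .
qed

lemma product_prob_space_U: "product_prob_space (\<lambda>_. U)"
proof -
  interpret prob_space U by (rule prob_space_U)
  show ?thesis by unfold_locales
qed

lemma measurable_coordinate:
  assumes "i \<in> T" shows "(\<lambda>x. x i) \<in> borel_measurable (PiM T (\<lambda>_. U))"
  using measurable_component_singleton[OF assms, of "\<lambda>_. U"]
  by (simp cong: measurable_cong_sets)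

text \<open>Start from the identity matrix and replace its rows by edges one at a time. If the
  determinant was nonzero before a replacement, it vanishes afterwards only when the new vertex lies
  in a translate of a proper subspace determined by the other points, and this has probability
  zero.\<close>

lemma AE_det_edges_nonzero:
  fixes g :: "'d \<Rightarrow> 'i"
  assumes T: "finite T" "insert t (range g) \<subseteq> T" and g: "inj g" "t \<notin> range g"
  shows "AE x in PiM T (\<lambda>_. U). det (\<chi> i. x (g i) - x t) \<noteq> 0"
proof -
  interpret product_prob_space "\<lambda>_. U" T by (rule product_prob_space_U)
  define W where "W S x i = (if i \<in> S then x (g i) - x t else axis i 1)" 
    for S :: "'d set" and x :: "'i \<Rightarrow> real^'d" and i
  have Wm: "(\<lambda>x. det (\<chi> i. W S x i)) \<in> borel_measurable (PiM T (\<lambda>_. U))" for S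
  proof (rule borel_measurable_det)
    fix i
    have "(\<lambda>x. x (g i) :: real^'d) \<in> borel_measurable (PiM T (\<lambda>_. U))"
      "(\<lambda>x. x t :: real^'d) \<in> borel_measurable (PiM T (\<lambda>_. U))"
      using T(2) by (auto intro!: measurable_coordinate)
    then show "(\<lambda>x. W S x i) \<in> borel_measurable (PiM T (\<lambda>_. U))"
      by (cases "i \<in> S") (auto simp: W_def)
  qed
  have "AE x in PiM T (\<lambda>_. U). det (\<chi> i. W S x i) \<noteq> 0" if "finite S" for S
    using that
  proof (induction S)
    case empty
    have "(\<chi> i. W {} x i) = mat 1" for x
      by (auto simp: W_def vec_eq_iff axis_def mat_def)
    then show ?case by simp
  next
    case (insert k S)
    let ?s = "g k"
    let ?T = "T - {?s}"
    have s: "insert ?s ?T = T" "finite ?T" "?s \<notin> ?T" using T by auto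
    define N where "N = {x \<in> space (PiM T (\<lambda>_. U)). det (\<chi> i. W S x i) \<noteq> 0 \<and> det (\<chi> i. W (insert k S) x i) = 0}"
    note Wm[measurable]
    have N[measurable]: "N \<in> sets (PiM T (\<lambda>_. U))" unfolding N_def by measurable
    have "emeasure (PiM T (\<lambda>_. U)) N = (\<integral>\<^sup>+x. indicator N x \<partial>PiM T (\<lambda>_. U))"
      by simp
    also have "\<dots> = (\<integral>\<^sup>+y. (\<integral>\<^sup>+u. indicator N (y(?s := u)) \<partial>U) \<partial>PiM ?T (\<lambda>_. U))"
      using product_nn_integral_insert[OF s(2,3), of "indicator N"] unfolding s(1) by simp
    also have "\<dots> = (\<integral>\<^sup>+y. 0 \<partial>PiM ?T (\<lambda>_. U))"
    proof (rule nn_integral_cong)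
      fix y :: "'i \<Rightarrow> real^'d"
      define V where "V i = W S y i" for i
      have st: "?s \<noteq> t" using g(2) by auto
      have gi: "g i \<noteq> ?s" if "i \<noteq> k" for i using g(1) that by (auto dest: injD)
      have WV: "W S (y(?s := u)) i = V i" for u i
        using insert.hyps gi[of i] st by (cases "i = k") (auto simp: V_def W_def)
      have WV': "W (insert k S) (y(?s := u)) i = (if i = k then u - y t else V i)" for u i
        using insert.hyps gi[of i] st by (auto simp: V_def W_def)
      define L where "L v = det (\<chi> i. if i = k then v else V i)" for v :: "real^'d"
      define N' where "N' = {v. L v = 0}"
      have "negligible ((+) (y t) ` N')" if V: "det (\<chi> i. V i) \<noteq> 0"
      proof (rule negligible_translation, rule negligible_lowdim)
        have "subspace N'"
        proof (rule subspaceI)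
          show "0 \<in> N'" using det_row_0[of k V] by (simp add: N'_def L_def)
          show "v + v' \<in> N'" if "v \<in> N'" "v' \<in> N'" for v v'
            using that det_row_add[of k "\<lambda>_. v" "\<lambda>_. v'" V] by (simp add: N'_def L_def)
          show "c *\<^sub>R v \<in> N'" if "v \<in> N'" for v c
            using that det_row_mul[of k c "\<lambda>_. v" V, unfolded scalar_mult_eq_scaleR]
            by (simp add: N'_def L_def)
        qed
        \<comment> \<open>The old row \<open>V k\<close> restores the matrix with nonzero
          determinant, so it lies outside \<open>N'\<close> and the subspace is proper.\<close>
        moreover have "(\<lambda>i. if i = k then V k else V i) = V" by auto
        then have "V k \<notin> N'" using V by (simp add: N'_def L_def)
        ultimately show "dim N' < DIM(real^'d)"
          by (metis UNIV_I dim_eq_full dim_subset_UNIV order_le_imp_less_or_eq span_eq_iff)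
      qed
      then have "AE u in U. \<not> (det (\<chi> i. V i) \<noteq> 0 \<and> L (u - y t) = 0)"
      proof (cases "det (\<chi> i. V i) = 0")
        case False
        then have "AE u in U. u \<notin> (+) (y t) ` N'"
          by (intro negligible_imp_AE_U \<open>det (\<chi> i. V i) \<noteq> 0 \<Longrightarrow> negligible ((+) (y t) ` N')\<close>)
        then show ?thesis
        proof (rule AE_mp, intro AE_I2 impI)
          fix u assume "u \<notin> (+) (y t) ` N'"
          then have "u - y t \<notin> N'" by (metis add.commute diff_add_cancel image_eqI)
          then show "\<not> (det (\<chi> i. V i) \<noteq> 0 \<and> L (u - y t) = 0)" by (simp add: N'_def)
        qed
      qed auto
      then have "AE u in U. indicator N (y(?s := u)) = (0::ennreal)"
      proof (rule AE_mp, intro AE_I2 impI)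
        fix u assume u: "\<not> (det (\<chi> i. V i) \<noteq> 0 \<and> L (u - y t) = 0)"
        have "W S (y(?s := u)) = V" "W (insert k S) (y(?s := u)) = (\<lambda>i. if i = k then u - y t else V i)"
          by (auto simp: WV WV')
        then have "y(?s := u) \<notin> N" using u by (simp add: N_def L_def)
        then show "indicator N (y(?s := u)) = (0::ennreal)" by simp
      qed
      then show "(\<integral>\<^sup>+u. indicator N (y(?s := u)) \<partial>U) = 0"
        by (subst nn_integral_cong_AE[of _ "\<lambda>_. 0"]) auto
    qed
    finally have "N \<in> null_sets (PiM T (\<lambda>_. U))" by (simp add: null_sets_def)
    then have "AE x in PiM T (\<lambda>_. U). x \<notin> N" by (rule AE_not_in)
    with insert.IH AE_space show ?case
      by eventually_elim (auto simp: N_def)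
  qed
  from this[of UNIV] show ?thesis by (simp add: W_def)
qed

text \<open>Almost surely the simplex is nondegenerate and has a dominant vertex \<open>s\<close>,
  so the integrand is bounded by a sum over the vertices. In each summand \<open>s\<close> is
  integrated first, with the other vertices fixed. As the integral over the line on the right is
  twice the one over \<open>v \<ge> 0\<close>, the density of the volume is at most
  \<open>fact (CARD('d) + 1) * 2 ^ (CARD('d) - 1)\<close>.\<close>

lemma nn_integral_simplex_volume_le:
  fixes F :: "real \<Rightarrow> real" and T :: "'i set"
  assumes F [measurable]: "F \<in> borel_measurable borel" and F0: "\<And>v. 0 \<le> F v"
    and d: "2 \<le> CARD('d)" and T: "finite T" "card T = CARD('d) + 1"
  shows "2 * (\<integral>\<^sup>+x. ennreal (F (measure lborel (convex hull (x ` T)))) \<partial>PiM T (\<lambda>_. U))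
    \<le> (of_nat (CARD('d) + 1) * (2 ^ (CARD('d) - 1) * fact CARD('d))) * (\<integral>\<^sup>+v. ennreal (F \<bar>v\<bar>) \<partial>lborel)"
proof -
  interpret product_prob_space "\<lambda>_. U" T by (rule product_prob_space_U)
  obtain r :: 'd where True by simp
  define e where "e = (axis r 1 :: real^'d)"
  have e: "e \<noteq> 0" by (simp add: e_def axis_eq_0_iff)
  \<comment> \<open>Dominance refers to a fixed row \<open>r\<close>, so each vertex
    \<open>s\<close> gets a base vertex of its own and an enumeration of the rest with
    \<open>s\<close> in place \<open>r\<close>.\<close>
  have ex: "\<exists>g t. inj g \<and> t \<notin> range g \<and> insert t (range g) = T \<and> g r = s" if s: "s \<in> T" for s :: 'i
  proof -
    have "card (T - {s}) \<noteq> 0" using T s d by simp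
    then obtain t where t: "t \<in> T" "t \<noteq> s" by (metis DiffE card.empty ex_in_conv singletonI)
    have "card (UNIV - {r}) = card (T - {t} - {s})" using T s t by simp
    then obtain h where h: "bij_betw h (UNIV - {r}) (T - {t} - {s})"
      using T finite_same_card_bij[of "UNIV - {r}" "T - {t} - {s}"] by auto
    define g where "g = (\<lambda>i. if i = r then s else h i)"
    have "bij_betw g (UNIV - {r}) (T - {t} - {s})"
      by (subst bij_betw_cong[where g = h]) (use h in \<open>auto simp: g_def\<close>)
    then have "bij_betw g (UNIV - {r} \<union> {r}) (T - {t} - {s} \<union> {g r})"
      by (intro notIn_Un_bij_betw) (auto simp: g_def)
    moreover have "UNIV - {r} \<union> {r} = UNIV" "T - {t} - {s} \<union> {g r} = T - {t}" using s t by (auto simp: g_def)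
    ultimately have "bij_betw g UNIV (T - {t})" by simp
    then have "inj g" "range g = T - {t}" by (auto simp: bij_betw_def)
    then show ?thesis using t by (intro exI[of _ g] exI[of _ t]) (auto simp: g_def)
  qed
  then obtain \<gamma> \<tau> where en: "\<And>s. s \<in> T \<Longrightarrow> inj (\<gamma> s) \<and> \<tau> s \<notin> range (\<gamma> s) \<and> insert (\<tau> s) (range (\<gamma> s)) = T \<and> \<gamma> s r = s"
    by metis
  define edge where "edge s x i = x (\<gamma> s i) - x (\<tau> s)" for s and x :: "'i \<Rightarrow> real^'d" and i
  define D where "D s x = det (\<chi> i. edge s x i)" for s x
  have vol: "measure lborel (convex hull (x ` T)) = \<bar>D s x\<bar> / fact CARD('d)" if "s \<in> T" for s x
    using measure_simplex[of x "\<tau> s" "\<gamma> s"] en[OF that] by (simp add: D_def edge_def)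
  define H where "H s x = ennreal (F (\<bar>D s x\<bar> / fact CARD('d))) * indicator {x. D s x \<noteq> 0 \<and> dominant_row (edge s x) e r} x" for s x
  have edge_m: "(\<lambda>x. edge s x i) \<in> borel_measurable (PiM T (\<lambda>_. U))" if "s \<in> T" for s i
    unfolding edge_def using en[OF that]
    by (intro borel_measurable_diff measurable_coordinate) auto
  have H_m: "H s \<in> borel_measurable (PiM T (\<lambda>_. U))" if "s \<in> T" for s
  proof -
    note edge_m[OF that, measurable]
    have [measurable]: "D s \<in> borel_measurable (PiM T (\<lambda>_. U))"
      unfolding D_def by (rule borel_measurable_det) (rule edge_m[OF that])
    have [measurable]: "Measurable.pred (PiM T (\<lambda>_. U)) (\<lambda>x. dominant_row (edge s x) e r)"
      using measurable_dominant_row[of "\<lambda>i x. edge s x i"] by simp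
    show ?thesis unfolding H_def by measurable
  qed
  have H_le: "2 * (\<integral>\<^sup>+x. H s x \<partial>PiM T (\<lambda>_. U)) \<le> 2 ^ (CARD('d) - 1) * fact CARD('d) * (\<integral>\<^sup>+v. ennreal (F \<bar>v\<bar>) \<partial>lborel)"
    (is "_ \<le> ?B") if s: "s \<in> T" for s
  proof -
    let ?T = "T - {s}"
    have ss: "insert s ?T = T" "finite ?T" "s \<notin> ?T" using T s by auto
    have g: "inj (\<gamma> s)" "\<tau> s \<notin> range (\<gamma> s)" "\<gamma> s r = s" using en[OF s] by auto
    have ts: "\<tau> s \<noteq> s" using g by (metis rangeI)
    have gi: "\<gamma> s i = s \<longleftrightarrow> i = r" for i using g by (metis injD)
    interpret P': prob_space "PiM ?T (\<lambda>_. U)" by (rule prob_space_PiM) (rule prob_space_U)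
    \<comment> \<open>Since \<open>s\<close> is not the base vertex and occurs in row
      \<open>r\<close> only, moving it changes just that row. This is the situation of
      \<open>nn_integral_dominant_fibre\<close>.\<close>
    have ed: "edge s (y(s := u)) = (edge s y)(r := u - y (\<tau> s))" for y u
      using ts by (auto simp: edge_def fun_eq_iff gi)
    have "2 * (\<integral>\<^sup>+x. H s x \<partial>PiM T (\<lambda>_. U)) = 2 * (\<integral>\<^sup>+y. (\<integral>\<^sup>+u. H s (y(s := u)) \<partial>U) \<partial>PiM ?T (\<lambda>_. U))"
      using product_nn_integral_insert[OF ss(2,3), of "H s"] H_m[OF s] unfolding ss(1) by simp
    also have "\<dots> = (\<integral>\<^sup>+y. 2 * (\<integral>\<^sup>+u. H s (y(s := u)) \<partial>U) \<partial>PiM ?T (\<lambda>_. U))"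
    proof (rule nn_integral_cmult[symmetric])
      have [measurable]: "H s \<in> borel_measurable (PiM (insert s ?T) (\<lambda>_. U))" using H_m[OF s] unfolding ss(1) .
      show "(\<lambda>y. \<integral>\<^sup>+u. H s (y(s := u)) \<partial>U) \<in> borel_measurable (PiM ?T (\<lambda>_. U))" by measurable
    qed
    also have "\<dots> \<le> (\<integral>\<^sup>+y. ?B \<partial>PiM ?T (\<lambda>_. U))"
    proof (rule nn_integral_mono)
      fix y :: "'i \<Rightarrow> real^'d" assume y: "y \<in> space (PiM ?T (\<lambda>_. U))"
      let ?w = "\<lambda>u. (edge s y)(r := u - y (\<tau> s))"
      have [measurable]: "(\<lambda>u. H s (y(s := u))) \<in> borel_measurable borel"
      proof -
        have [measurable]: "(\<lambda>q. ?w q i) \<in> borel_measurable borel" for i by (cases "i = r") auto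
        have [measurable]: "Measurable.pred borel (\<lambda>q. dominant_row (?w q) e r)"
          using measurable_dominant_row[of "\<lambda>i q. ?w q i" borel e r] by (simp add: fun_upd_def)
        show ?thesis unfolding H_def D_def indicator_def mem_Collect_eq ed by measurable
      qed
      have "2 * (\<integral>\<^sup>+u. H s (y(s := u)) \<partial>U) \<le> 2 * (\<integral>\<^sup>+u. H s (y(s := u)) \<partial>lborel)"
        by (intro mult_left_mono nn_integral_U_le) auto
      also have "\<dots> \<le> ?B"
        using nn_integral_dominant_fibre[OF F F0 d, of "edge s y" r "y (\<tau> s)" e]
        unfolding H_def D_def indicator_def mem_Collect_eq ed .
      finally show "2 * (\<integral>\<^sup>+u. H s (y(s := u)) \<partial>U) \<le> ?B" .
    qed
    also have "\<dots> = ?B" by (simp add: P'.emeasure_space_1)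
    finally show ?thesis .
  qed
  have "T \<noteq> {}" using T by auto
  then obtain s0 where s0: "s0 \<in> T" by blast
  have "AE x in PiM T (\<lambda>_. U). D s0 x \<noteq> 0"
    using AE_det_edges_nonzero[of T "\<tau> s0" "\<gamma> s0"] en[OF s0] T by (simp add: D_def edge_def)
  then have "AE x in PiM T (\<lambda>_. U). ennreal (F (measure lborel (convex hull (x ` T)))) \<le> (\<Sum>s\<in>T. H s x)"
  proof (rule AE_mp, intro AE_I2 impI)
    fix x assume D0: "D s0 x \<noteq> 0"
    obtain s where s: "s \<in> insert (\<tau> s0) (range (\<gamma> s0))"
      "\<And>g' t'. inj g' \<Longrightarrow> t' \<notin> range g' \<Longrightarrow> insert t' (range g') = insert (\<tau> s0) (range (\<gamma> s0)) \<Longrightarrow> g' r = s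
       \<Longrightarrow> dominant_row (\<lambda>i. x (g' i) - x t') e r"
      using exists_dominant_vertex[of x "\<gamma> s0" "\<tau> s0" e r] D0 e en[OF s0] unfolding D_def edge_def by blast
    then have sT: "s \<in> T" using en[OF s0] by simp
    have "dominant_row (edge s x) e r"
      unfolding edge_def[abs_def] using s(2)[of "\<gamma> s" "\<tau> s"] en[OF sT] en[OF s0] by simp
    moreover have "D s x \<noteq> 0" using vol[OF sT, of x] vol[OF s0, of x] D0 by auto
    ultimately have "ennreal (F (measure lborel (convex hull (x ` T)))) = H s x"
      by (simp add: H_def vol[OF sT])
    also have "\<dots> \<le> (\<Sum>s\<in>T. H s x)"
      using T sT by (intro member_le_sum) auto
    finally show "ennreal (F (measure lborel (convex hull (x ` T)))) \<le> (\<Sum>s\<in>T. H s x)" .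
  qed
  then have "(\<integral>\<^sup>+x. ennreal (F (measure lborel (convex hull (x ` T)))) \<partial>PiM T (\<lambda>_. U)) \<le> (\<integral>\<^sup>+x. (\<Sum>s\<in>T. H s x) \<partial>PiM T (\<lambda>_. U))"
    by (rule nn_integral_mono_AE)
  also have "\<dots> = (\<Sum>s\<in>T. \<integral>\<^sup>+x. H s x \<partial>PiM T (\<lambda>_. U))"
    by (rule nn_integral_sum) (rule H_m)
  finally have "2 * (\<integral>\<^sup>+x. ennreal (F (measure lborel (convex hull (x ` T)))) \<partial>PiM T (\<lambda>_. U)) \<le> (\<Sum>s\<in>T. 2 * (\<integral>\<^sup>+x. H s x \<partial>PiM T (\<lambda>_. U)))"
    unfolding sum_distrib_left[symmetric] by (rule mult_left_mono) simp
  also have "\<dots> \<le> (\<Sum>s\<in>T. 2 ^ (CARD('d) - 1) * fact CARD('d) * (\<integral>\<^sup>+v. ennreal (F \<bar>v\<bar>) \<partial>lborel))"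
    by (rule sum_mono) (rule H_le)
  also have "\<dots> = (of_nat (CARD('d) + 1) * (2 ^ (CARD('d) - 1) * fact CARD('d))) * (\<integral>\<^sup>+v. ennreal (F \<bar>v\<bar>) \<partial>lborel)"
    by (simp only: sum_constant T(2) mult.assoc)
  finally show ?thesis .
qed

end

section \<open>Islands with a given simplex of maximal volume\<close>

lemma exists_simplex_enumeration:
  assumes "finite T" "card T = CARD('d::finite) + 1" "t \<in> T"
  obtains g :: "'d::finite \<Rightarrow> 'i" where "inj g" "t \<notin> range g" "insert t (range g) = T"
proof -
  have "card (UNIV :: 'd set) = card (T - {t})" using assms by simp
  then obtain g :: "'d \<Rightarrow> 'i" where "bij_betw g UNIV (T - {t})"
    using assms finite_same_card_bij[of "UNIV :: 'd set" "T - {t}"] by auto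
  then show thesis using that[of g] assms by (auto simp: bij_betw_def)
qed

context unit_volume_body
begin

text \<open>Up to sign and a constant the volume is a determinant, and determinants are
  measurable.\<close>

lemma measurable_simplex_volume:
  assumes T: "finite T" "card T = CARD('d) + 1" "T \<subseteq> I"
  shows "(\<lambda>x. measure lborel (convex hull (x ` T))) \<in> borel_measurable (PiM I (\<lambda>_. U))"
proof -
  have "T \<noteq> {}" using T by auto
  then obtain t where t: "t \<in> T" by blast
  obtain g :: "'d \<Rightarrow> _" where g: "insert t (range g) = T"
    using exists_simplex_enumeration[OF T(1,2) t] by blast
  have "(\<lambda>x. det (\<chi> i. x (g i) - x t)) \<in> borel_measurable (PiM I (\<lambda>_. U))"
    using g T(3) by (intro borel_measurable_det borel_measurable_diff measurable_coordinate) auto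
  then show ?thesis
    using measure_simplex[of _ t g] unfolding g by simp
qed

lemma AE_simplex_volume_nonzero:
  assumes I: "finite I" and T: "card T = CARD('d) + 1" "T \<subseteq> I"
  shows "AE x in PiM I (\<lambda>_. U). measure lborel (convex hull (x ` T)) \<noteq> 0"
proof -
  have fT: "finite T" using I T finite_subset by blast
  have "T \<noteq> {}" using T by auto
  then obtain t where t: "t \<in> T" by blast
  obtain g :: "'d \<Rightarrow> _" where g: "inj g" "t \<notin> range g" "insert t (range g) = T"
    using exists_simplex_enumeration[OF fT T(1) t] by blast
  have "AE x in PiM I (\<lambda>_. U). det (\<chi> i. x (g i) - x t) \<noteq> 0"
    using AE_det_edges_nonzero[OF I _ g(1,2)] g(3) T(2) by simp
  then show ?thesis
    using measure_simplex[of _ t g] unfolding g(3) by simp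
qed

text \<open>Maximality is weakened to exchanges of a single vertex of \<open>T\<close>, and the
  points outside \<open>J\<close> only avoid the simplex of \<open>T\<close> instead of the hull of
  all points of \<open>J\<close>. Given the points of \<open>T\<close>, every other point is then
  restricted on its own, so independence yields a product.\<close>

definition max_simplex_event :: "'i set \<Rightarrow> 'i set \<Rightarrow> 'i set \<Rightarrow> ('i \<Rightarrow> real^'d) \<Rightarrow> bool" where
  "max_simplex_event I J T x \<longleftrightarrow>
     (\<forall>j\<in>J - T. \<forall>t\<in>T. measure lborel (convex hull (x ` insert j (T - {t}))) \<le> measure lborel (convex hull (x ` T))) \<and>
     (\<forall>j\<in>I - J. x j \<notin> convex hull (x ` T))"

lemma measurable_max_simplex_event:
  assumes I: "finite I" and J: "J \<subseteq> I" and T: "T \<subseteq> J" "card T = CARD('d) + 1"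
  shows "Measurable.pred (PiM I (\<lambda>_. U)) (max_simplex_event I J T)"
proof -
  have fin: "finite J" "finite T" using I J T(1) by (auto intro: finite_subset)
  have [measurable]: "(\<lambda>x. measure lborel (convex hull (x ` T))) \<in> borel_measurable (PiM I (\<lambda>_. U))"
    using assms fin by (intro measurable_simplex_volume) auto
  have m1: "Measurable.pred (PiM I (\<lambda>_. U)) (\<lambda>x. measure lborel (convex hull (x ` insert j (T - {t}))) \<le> measure lborel (convex hull (x ` T)))"
    if "j \<in> J - T" "t \<in> T" for j t
  proof -
    have "card (insert j (T - {t})) = CARD('d) + 1" using that fin T by simp
    then have [measurable]: "(\<lambda>x. measure lborel (convex hull (x ` insert j (T - {t})))) \<in> borel_measurable (PiM I (\<lambda>_. U))"
      using that assms fin by (intro measurable_simplex_volume) auto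
    show ?thesis unfolding pred_def by (rule borel_measurable_le) fact+
  qed
  have m2: "Measurable.pred (PiM I (\<lambda>_. U)) (\<lambda>x. x j \<notin> convex hull (x ` T))" if "j \<in> I - J" for j
    using that assms fin measurable_notin_convex_hull[of T j "\<lambda>i x. x i" "PiM I (\<lambda>_. U)"]
    by (auto intro!: measurable_coordinate)
  show ?thesis
    unfolding max_simplex_event_def
    using fin I by (intro pred_intros_logic pred_intros_finite m1 m2) auto
qed

text \<open>Fix the points of \<open>T\<close> and let \<open>v\<close> be the volume of their
  simplex. Points of \<open>J - T\<close> lie in a parallelotope of volume
  \<open>2 ^ CARD('d) * fact CARD('d) * v\<close>, points outside \<open>J\<close> avoid a set of
  probability \<open>v\<close>, and independence multiplies the bounds. The indicator in
  \<open>F\<close> keeps it nonnegative on the whole line.\<close>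

lemma emeasure_max_simplex_event_le:
  assumes I: "finite I" and J: "J \<subseteq> I" and T: "T \<subseteq> J" "card T = CARD('d) + 1"
  defines "F \<equiv> \<lambda>v. (2 ^ CARD('d) * fact CARD('d) * v) ^ card (J - T) * (1 - v) ^ card (I - J) * indicator {0..1} v :: real"
  shows "emeasure (PiM I (\<lambda>_. U)) {x \<in> space (PiM I (\<lambda>_. U)). max_simplex_event I J T x}
    \<le> (\<integral>\<^sup>+y. ennreal (F (measure lborel (convex hull (y ` T)))) \<partial>PiM T (\<lambda>_. U))"
proof -
  interpret product_prob_space "\<lambda>_. U" I by (rule product_prob_space_U)
  let ?R = "I - T"
  let ?d = "CARD('d)"
  have fin: "finite J" "finite T" using I J T(1) by (auto intro: finite_subset)
  have IT: "T \<union> ?R = I" "T \<inter> ?R = {}" "finite ?R" using assms by auto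
  have "T \<noteq> {}" using T by auto
  then obtain t where t: "t \<in> T" by blast
  obtain g :: "'d \<Rightarrow> _" where g: "inj g" "t \<notin> range g" "insert t (range g) = T"
    using exists_simplex_enumeration[OF fin(2) T(2) t] by blast
  define E where "E = {x \<in> space (PiM I (\<lambda>_. U)). max_simplex_event I J T x}"
  have E [measurable]: "E \<in> sets (PiM I (\<lambda>_. U))"
    using measurable_max_simplex_event[OF I J T] unfolding E_def by measurable
  have "emeasure (PiM I (\<lambda>_. U)) E = (\<integral>\<^sup>+x. indicator E x \<partial>PiM (T \<union> ?R) (\<lambda>_. U))"
    unfolding IT(1) by simp
  also have "\<dots> = (\<integral>\<^sup>+y. (\<integral>\<^sup>+z. indicator E (merge T ?R (y, z)) \<partial>PiM ?R (\<lambda>_. U)) \<partial>PiM T (\<lambda>_. U))"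
    by (rule product_nn_integral_fold) (use IT fin in \<open>simp_all add: IT(1)\<close>)
  also have "\<dots> \<le> (\<integral>\<^sup>+y. ennreal (F (measure lborel (convex hull (y ` T)))) \<partial>PiM T (\<lambda>_. U))"
  proof (rule nn_integral_mono_AE)
    have nz: "AE y in PiM T (\<lambda>_. U). measure lborel (convex hull (y ` T)) \<noteq> 0"
      using fin T by (intro AE_simplex_volume_nonzero) auto
    have "AE u in U. u \<in> K"
      unfolding U_def by (rule AE_uniform_measureI) auto
    then have "AE y in PiM T (\<lambda>_. U). y i \<in> K" if "i \<in> T" for i
      using that by (intro AE_PiM_component prob_space_U) auto
    then have "AE y in PiM T (\<lambda>_. U). \<forall>i\<in>T. y i \<in> K"
      using fin by (intro AE_finite_allI) auto
    with nz show "AE y in PiM T (\<lambda>_. U). (\<integral>\<^sup>+z. indicator E (merge T ?R (y, z)) \<partial>PiM ?R (\<lambda>_. U)) \<le> ennreal (F (measure lborel (convex hull (y ` T))))"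
    proof eventually_elim
      case (elim y)
      define C where "C = convex hull (y ` T)"
      define v where "v = measure lborel C"
      define D where "D = det (\<chi> i. y (g i) - y t)"
      have vD: "v = \<bar>D\<bar> / fact ?d" unfolding v_def C_def D_def using measure_simplex[of y t g] g(3) by simp
      have v0: "v \<noteq> 0" using elim by (simp add: v_def C_def)
      then have D0: "D \<noteq> 0" by (simp add: vD)
      have cC: "compact C" unfolding C_def using fin by (simp add: finite_imp_compact_convex_hull)
      then have [measurable]: "C \<in> sets borel" by (rule borel_compact)
      \<comment> \<open>By convexity the whole simplex lies in \<open>K\<close>, so its probability
        under \<open>U\<close> is exactly \<open>v\<close>.\<close>
      have CK: "C \<subseteq> K" unfolding C_def using elim convex_K by (intro hull_minimal) auto
      have ev: "emeasure lborel C = ennreal v"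
        unfolding v_def using emeasure_compact_finite[OF cC] by (simp add: emeasure_eq_ennreal_measure)
      have "emeasure lborel C \<le> emeasure lborel K" using CK by (intro emeasure_mono) auto
      then have v1: "0 \<le> v" "v \<le> 1" by (auto simp: ev emeasure_K v_def)
      \<comment> \<open>The points whose coordinates with respect to the base vertex
        \<open>y t\<close> and the edges lie in \<open>[-1, 1]\<close>.\<close>
      define Q where "Q = (\<lambda>a::real^'d. y t + (\<Sum>i\<in>UNIV. a$i *\<^sub>R (y (g i) - y t))) ` cbox (\<chi> i. -1) (\<chi> i. 1)"
      have "compact Q" unfolding Q_def by (intro compact_continuous_image continuous_intros) simp
      then have [measurable]: "Q \<in> sets borel" by (rule borel_compact)
      have "emeasure lborel (cbox (\<chi> i. -1) (\<chi> i. 1) :: (real^'d) set) = ennreal (2 ^ ?d)"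
      proof -
        have ne: "cbox (\<chi> i. -1) (\<chi> i. 1) \<noteq> ({} :: (real^'d) set)" by (simp add: interval_ne_empty_cart)
        show ?thesis
          using content_cbox_cart[OF ne] emeasure_lborel_cbox_finite[of "\<chi> i. -1" "\<chi> i. 1 :: real^'d"]
          by (subst emeasure_eq_ennreal_measure) auto
      qed
      then have eQ: "emeasure lborel Q = ennreal (2 ^ ?d * fact ?d * v)"
        unfolding Q_def
        by (subst emeasure_lborel_rows_image) (auto simp: D_def[symmetric] vD ennreal_mult[symmetric] mult.commute)
      define B where "B j = (if j \<in> J then Q else - C)" for j
      have sub: "merge T ?R (y, z) \<in> E \<Longrightarrow> z \<in> Pi\<^sub>E ?R B" if z: "z \<in> space (PiM ?R (\<lambda>_. U))" for z
      proof -
        define x where "x = merge T ?R (y, z)"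
        assume "merge T ?R (y, z) \<in> E"
        then have ms: "max_simplex_event I J T x" by (simp add: E_def x_def)
        have xT: "x i = y i" if "i \<in> T" for i using that by (simp add: x_def merge_def)
        have xR: "x i = z i" if "i \<in> ?R" for i using that by (simp add: x_def merge_def)
        have imT: "x ` T = y ` T" using xT by (intro image_cong) auto
        have "z j \<in> B j" if j: "j \<in> ?R" for j
        proof (cases "j \<in> J")
          case False
          then have "x j \<notin> convex hull (x ` T)" using ms j unfolding max_simplex_event_def by blast
          then show ?thesis using False j by (simp add: B_def imT xR C_def)
        next
          case True
          obtain a where a: "z j - y t = (\<Sum>l\<in>UNIV. a l *\<^sub>R (y (g l) - y t))"
            using det_nonzero_imp_combination[of "\<lambda>i. y (g i) - y t"] D0 unfolding D_def by blast
          have "\<bar>a i\<bar> \<le> 1" for i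
          proof -
            \<comment> \<open>Exchanging the vertex \<open>g i\<close> for \<open>j\<close> keeps
              the base vertex and changes row \<open>i\<close> only. By Cramer's rule it multiplies
              the volume by \<open>\<bar>a i\<bar>\<close>, which maximality bounds by one.\<close>
            let ?g = "g(i := j)"
            have gT: "g l \<in> T" for l using g(3) by auto
            have jT: "j \<notin> T" using j by simp
            have rg: "insert t (range ?g) = insert j (T - {g i})"
            proof
              show "insert t (range ?g) \<subseteq> insert j (T - {g i})"
                using g(1,2) gT t by (auto simp: inj_eq)
              show "insert j (T - {g i}) \<subseteq> insert t (range ?g)"
              proof
                fix s assume s: "s \<in> insert j (T - {g i})"
                show "s \<in> insert t (range ?g)"
                proof (cases "s = j")
                  case True
                  then show ?thesis by (auto simp: image_iff intro!: exI[of _ i])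
                next
                  case False
                  then have "s = t \<or> (\<exists>l. s = g l \<and> l \<noteq> i)" using s g(3) by auto
                  then show ?thesis by (auto simp: image_iff)
                qed
              qed
            qed
            have "measure lborel (convex hull (x ` insert j (T - {g i}))) \<le> measure lborel (convex hull (x ` T))"
              using ms True jT gT[of i] unfolding max_simplex_event_def by blast
            then have "\<bar>det (\<chi> l. x (?g l) - x t)\<bar> / fact ?d \<le> v"
              unfolding rg[symmetric] measure_simplex imT C_def[symmetric] v_def[symmetric] .
            moreover have "(\<lambda>l. x (?g l) - x t) = (\<lambda>l. if l = i then (\<Sum>l\<in>UNIV. a l *\<^sub>R (y (g l) - y t)) else y (g l) - y t)"
              by (simp add: fun_eq_iff xT[OF t] xT[OF gT] xR[OF j] a)
            then have "det (\<chi> l. x (?g l) - x t) = a i * D"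
              unfolding D_def by (simp only: det_replace_row_combination)
            ultimately have "\<bar>a i\<bar> * v \<le> v" unfolding vD by (simp add: abs_mult)
            then show ?thesis using v0 v1 by simp
          qed
          then have "(\<chi> i. a i) \<in> cbox (\<chi> i. -1) (\<chi> i. 1)"
            by (auto simp: mem_box_cart abs_le_iff minus_le_iff)
          moreover have "z j = y t + (\<Sum>i\<in>UNIV. (\<chi> i. a i)$i *\<^sub>R (y (g i) - y t))"
            using a by (simp add: algebra_simps)
          ultimately have "z j \<in> Q" unfolding Q_def by (rule rev_image_eqI)
          then show ?thesis using True by (simp add: B_def)
        qed
        then show "z \<in> Pi\<^sub>E ?R B" using z by (auto simp: space_PiM)
      qed
      have BB: "B j \<in> sets U" for j by (simp add: B_def)
      have "(\<integral>\<^sup>+z. indicator E (merge T ?R (y, z)) \<partial>PiM ?R (\<lambda>_. U)) \<le> (\<integral>\<^sup>+z. indicator (Pi\<^sub>E ?R B) z \<partial>PiM ?R (\<lambda>_. U))"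
        by (intro nn_integral_mono) (auto simp: indicator_def dest: sub)
      also have "\<dots> = emeasure (PiM ?R (\<lambda>_. U)) (Pi\<^sub>E ?R B)"
        using IT BB by (intro nn_integral_indicator sets_PiM_I_finite) auto
      also have "\<dots> = (\<Prod>j\<in>?R. emeasure U (B j))"
        using IT(3) BB by (intro emeasure_PiM) auto
      also have "\<dots> \<le> (\<Prod>j\<in>?R. ennreal (if j \<in> J then 2 ^ ?d * fact ?d * v else 1 - v))"
      proof (rule prod_mono_ennreal)
        fix j assume "j \<in> ?R"
        show "emeasure U (B j) \<le> ennreal (if j \<in> J then 2 ^ ?d * fact ?d * v else 1 - v)"
        proof (cases "j \<in> J")
          case True
          have "emeasure U Q \<le> emeasure lborel Q" by (subst emeasure_U) (auto intro!: emeasure_mono)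
          then show ?thesis using True by (simp add: B_def eQ)
        next
          case False
          have "emeasure U (- C) = emeasure lborel (K - C)" by (subst emeasure_U) (auto simp: Diff_eq)
          also have "\<dots> = emeasure lborel K - emeasure lborel C"
            using CK by (intro emeasure_Diff) (auto simp: ev)
          also have "\<dots> = ennreal (1 - v)"
            using v1 by (simp add: emeasure_K ev ennreal_minus flip: ennreal_1)
          finally show ?thesis using False by (simp add: B_def)
        qed
      qed
      also have "\<dots> = ennreal (\<Prod>j\<in>?R. if j \<in> J then 2 ^ ?d * fact ?d * v else 1 - v)"
        using v1 by (intro prod_ennreal) auto
      also have "(\<Prod>j\<in>?R. if j \<in> J then 2 ^ ?d * fact ?d * v else 1 - v) = F v"
      proof -
        have "?R \<inter> J = J - T" "?R \<inter> - J = I - J" using J T by auto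
        then show ?thesis using IT(3) v1 by (simp add: prod.If_cases F_def)
      qed
      finally show ?case by (simp add: v_def C_def)
    qed
  qed
  finally show ?thesis by (simp add: E_def)
qed

end

section \<open>The expected number of islands\<close>

lemma nn_integral_beta:
  "(\<integral>\<^sup>+v. ennreal (v ^ m * (1 - v) ^ N * indicator {0..1} v) \<partial>lborel)
    = ennreal (fact m * fact N / fact (m + N + 1))"
proof -
  have "((\<lambda>t. t powr (real (m + 1) - 1) * (1 - t) powr (real (N + 1) - 1)) has_integral Beta (real (m + 1)) (real (N + 1))) {0..1}"
    by (rule has_integral_Beta_real) auto
  also have "Beta (real (m + 1)) (real (N + 1)) = fact m * fact N / fact (m + N + 1)"
    using Gamma_fact[of m, where 'a = real] Gamma_fact[of N, where 'a = real] Gamma_fact[of "m + N + 1", where 'a = real]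
    by (simp add: Beta_def add_ac)
  \<comment> \<open>The two forms of the integrand can differ at the end points, because
    \<open>0 powr 0 = 0\<close> but \<open>0 ^ 0 = 1\<close>.\<close>
  finally have "((\<lambda>t. t ^ m * (1 - t) ^ N) has_integral fact m * fact N / fact (m + N + 1)) {0..1::real}"
    by (rule has_integral_spike_finite[of "{0, 1}", rotated 2]) (auto simp: powr_realpow)
  then have "(\<integral>\<^sup>+v. ennreal (indicator {0..1} v * (v ^ m * (1 - v) ^ N)) \<partial>lborel) = ennreal (fact m * fact N / fact (m + N + 1))"
    by (intro nn_integral_has_integral_lebesgue) auto
  then show ?thesis by (simp add: mult.commute)
qed

lemma nn_integral_lborel_abs:
  fixes F :: "real \<Rightarrow> ennreal"
  assumes F [measurable]: "F \<in> borel_measurable borel"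
  shows "(\<integral>\<^sup>+v. F \<bar>v\<bar> \<partial>lborel) = 2 * (\<integral>\<^sup>+v. F v * indicator {0..} v \<partial>lborel)"
proof -
  have "(\<integral>\<^sup>+v. F \<bar>v\<bar> \<partial>lborel) = (\<integral>\<^sup>+v. F v * indicator {0..} v + F (- v) * indicator {0..} (- v) \<partial>lborel)"
    using AE_lborel_singleton[of "0::real"]
    by (intro nn_integral_cong_AE) (auto simp: indicator_def elim!: eventually_mono)
  also have "\<dots> = (\<integral>\<^sup>+v. F v * indicator {0..} v \<partial>lborel) + (\<integral>\<^sup>+v. F (- v) * indicator {0..} (- v) \<partial>lborel)"
    by (intro nn_integral_add) auto
  also have "(\<integral>\<^sup>+v. F (- v) * indicator {0..} (- v) \<partial>lborel) = (\<integral>\<^sup>+v. F v * indicator {0..} v \<partial>lborel)"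
    using nn_integral_real_affine[of "\<lambda>v. F v * indicator {0..} v" "-1" 0] by simp
  finally show ?thesis by (simp add: mult_2)
qed

section \<open>Islands as index sets, and measurability of their number\<close>

lemma measurable_card_image:
  fixes X :: "'i \<Rightarrow> 'w \<Rightarrow> 'a::euclidean_space"
  assumes "finite J" "\<And>i. i \<in> J \<Longrightarrow> X i \<in> borel_measurable M"
  shows "(\<lambda>\<omega>. card ((\<lambda>i. X i \<omega>) ` J)) \<in> measurable M (count_space UNIV)"
  using assms
proof (induction J)
  case (insert a J)
  have [measurable]: "X a \<in> borel_measurable M" using insert.prems by auto
  have m: "(\<lambda>\<omega>. card ((\<lambda>i. X i \<omega>) ` J)) \<in> measurable M (count_space UNIV)"
    using insert by auto
  have p: "Measurable.pred M (\<lambda>\<omega>. \<exists>b\<in>J. X a \<omega> = X b \<omega>)"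
  proof (rule pred_intros_finite(4))
    fix b assume "b \<in> J"
    then have [measurable]: "X b \<in> borel_measurable M" using insert.prems by auto
    show "Measurable.pred M (\<lambda>\<omega>. X a \<omega> = X b \<omega>)" by measurable
  qed (use insert in auto)
  have "card ((\<lambda>i. X i \<omega>) ` insert a J) = (if \<exists>b\<in>J. X a \<omega> = X b \<omega> then card ((\<lambda>i. X i \<omega>) ` J) else Suc (card ((\<lambda>i. X i \<omega>) ` J)))" for \<omega>
    using insert.hyps by (auto simp: card_insert_if image_iff)
  then show ?case using m p by simp
qed simp

text \<open>An island corresponds to the set of all indices whose points belong to it. The condition
  on the indices outside \<open>J\<close> forces \<open>J\<close> to be this full set, so no island
  is counted twice when points coincide. For the same reason the cardinality is taken of the image
  and not of \<open>J\<close>.\<close>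

lemma num_k_islands_image:
  fixes x :: "'i \<Rightarrow> 'a::real_vector"
  assumes "finite I"
  shows "num_k_islands k (x ` I)
    = card {J \<in> Pow I. card (x ` J) = k \<and> (\<forall>j\<in>I - J. x j \<notin> convex hull (x ` J))}"
proof -
  let ?\<J> = "{J \<in> Pow I. card (x ` J) = k \<and> (\<forall>j\<in>I - J. x j \<notin> convex hull (x ` J))}"
  have "bij_betw ((`) x) ?\<J> {S. k_island k (x ` I) S}"
  proof (rule bij_betwI[where g = "\<lambda>S. {i \<in> I. x i \<in> S}"])
    show "(`) x \<in> ?\<J> \<rightarrow> {S. k_island k (x ` I) S}"
      by (auto simp: k_island_def intro: hull_inc)
    show "(\<lambda>S. {i \<in> I. x i \<in> S}) \<in> {S. k_island k (x ` I) S} \<rightarrow> ?\<J>"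
    proof
      fix S assume "S \<in> {S. k_island k (x ` I) S}"
      then have S: "S \<subseteq> x ` I" "card S = k" "convex hull S \<inter> x ` I = S" by (auto simp: k_island_def)
      have im: "x ` {i \<in> I. x i \<in> S} = S" using S(1) by auto
      show "{i \<in> I. x i \<in> S} \<in> ?\<J>"
        unfolding mem_Collect_eq im using S by auto
    qed
    show "{i \<in> I. x i \<in> x ` J} = J" if "J \<in> ?\<J>" for J
      using that by (auto intro: hull_inc)
    show "x ` {i \<in> I. x i \<in> S} = S" if "S \<in> {S. k_island k (x ` I) S}" for S
      using that by (auto simp: k_island_def)
  qed
  then show ?thesis unfolding num_k_islands_def by (rule bij_betw_same_card[symmetric])
qed

lemma measurable_num_k_islands:
  fixes X :: "'i \<Rightarrow> 'w \<Rightarrow> 'a::euclidean_space"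
  assumes I: "finite I" and X: "\<And>i. i \<in> I \<Longrightarrow> X i \<in> borel_measurable M"
  shows "(\<lambda>\<omega>. real (num_k_islands k ((\<lambda>i. X i \<omega>) ` I))) \<in> borel_measurable M"
proof -
  let ?P = "\<lambda>J \<omega>. card ((\<lambda>i. X i \<omega>) ` J) = k \<and> (\<forall>j\<in>I - J. X j \<omega> \<notin> convex hull ((\<lambda>i. X i \<omega>) ` J))"
  have P: "Measurable.pred M (?P J)" if J: "J \<in> Pow I" for J
  proof -
    have fin: "finite J" using J I finite_subset by auto
    have [measurable]: "(\<lambda>\<omega>. card ((\<lambda>i. X i \<omega>) ` J)) \<in> measurable M (count_space UNIV)"
      using fin J X by (intro measurable_card_image) auto
    have "Measurable.pred M (\<lambda>\<omega>. \<forall>j\<in>I - J. X j \<omega> \<notin> convex hull ((\<lambda>i. X i \<omega>) ` J))"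
      using fin J X I by (intro pred_intros_finite(3) measurable_notin_convex_hull) auto
    moreover have "Measurable.pred M (\<lambda>\<omega>. card ((\<lambda>i. X i \<omega>) ` J) = k)" by measurable
    ultimately show ?thesis unfolding pred_def by (intro sets.sets_Collect_conj)
  qed
  have "real (num_k_islands k ((\<lambda>i. X i \<omega>) ` I)) = (\<Sum>J\<in>Pow I. if ?P J \<omega> then 1 else 0)" for \<omega>
    using I by (simp add: num_k_islands_image sum.If_cases Collect_conj_eq Pow_def)
  moreover have "(\<lambda>\<omega>. \<Sum>J\<in>Pow I. if ?P J \<omega> then 1 else 0 :: real) \<in> borel_measurable M"
    using P by (intro borel_measurable_sum measurable_If) auto
  ultimately show ?thesis by simp
qed

context unit_volume_body
begin

text \<open>The bound on the density of the simplex volume leaves a beta integral. Extending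
  \<open>F\<close> evenly to the whole line doubles the integral, which cancels the factor 2 in
  \<open>nn_integral_simplex_volume_le\<close>.\<close>

lemma emeasure_max_simplex_event_le_beta:
  assumes d: "2 \<le> CARD('d)" and I: "finite I" and J: "J \<subseteq> I" and T: "T \<subseteq> J" "card T = CARD('d) + 1"
    and m: "card (J - T) = m" and N: "card (I - J) = N"
  shows "emeasure (PiM I (\<lambda>_. U)) {x \<in> space (PiM I (\<lambda>_. U)). max_simplex_event I J T x}
    \<le> ennreal (fact (CARD('d) + 1) * 2 ^ (CARD('d) - 1) * (2 ^ CARD('d) * fact CARD('d)) ^ m
        * (fact m * fact N / fact (m + N + 1)))"
proof -
  let ?d = "CARD('d)"
  let ?c = "2 ^ ?d * fact ?d :: real"
  define \<beta> :: real where "\<beta> = fact m * fact N / fact (m + N + 1)"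
  have \<beta>: "\<beta> \<ge> 0" by (simp add: \<beta>_def)
  define F where "F = (\<lambda>v::real. (?c * v) ^ m * (1 - v) ^ N * indicator {0..1} v)"
  have F0: "0 \<le> F v" for v by (auto simp: F_def indicator_def)
  have [measurable]: "F \<in> borel_measurable borel" unfolding F_def by measurable
  have finT: "finite T" using I J T finite_subset by metis
  have "(\<integral>\<^sup>+v. ennreal (F \<bar>v\<bar>) \<partial>lborel) = 2 * (\<integral>\<^sup>+v. ennreal (F v) * indicator {0..} v \<partial>lborel)"
    by (rule nn_integral_lborel_abs[of "\<lambda>v. ennreal (F v)"]) simp
  also have "(\<integral>\<^sup>+v. ennreal (F v) * indicator {0..} v \<partial>lborel)
      = (\<integral>\<^sup>+v. ennreal (?c ^ m) * ennreal (v ^ m * (1 - v) ^ N * indicator {0..1} v) \<partial>lborel)"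
    by (intro nn_integral_cong) (auto simp: F_def indicator_def power_mult_distrib mult.assoc ennreal_mult)
  also have "\<dots> = ennreal (?c ^ m) * ennreal \<beta>"
    unfolding \<beta>_def by (subst nn_integral_cmult) (simp_all only: nn_integral_beta, measurable)
  finally have Psi: "(\<integral>\<^sup>+v. ennreal (F \<bar>v\<bar>) \<partial>lborel) = 2 * ennreal (?c ^ m * \<beta>)"
    using \<beta> by (simp add: ennreal_mult)
  let ?E = "emeasure (PiM I (\<lambda>_. U)) {x \<in> space (PiM I (\<lambda>_. U)). max_simplex_event I J T x}"
  have "2 * ?E \<le> 2 * (\<integral>\<^sup>+y. ennreal (F (measure lborel (convex hull (y ` T)))) \<partial>PiM T (\<lambda>_. U))"
    using emeasure_max_simplex_event_le[OF I J T] unfolding m N F_def by (rule mult_left_mono) simp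
  also have "\<dots> \<le> of_nat (?d + 1) * (2 ^ (?d - 1) * fact ?d) * (\<integral>\<^sup>+v. ennreal (F \<bar>v\<bar>) \<partial>lborel)"
    using F0 d finT T(2) by (intro nn_integral_simplex_volume_le) auto
  also have "\<dots> = 2 * (of_nat (?d + 1) * (2 ^ (?d - 1) * fact ?d) * ennreal (?c ^ m * \<beta>))"
    unfolding Psi by (simp only: mult_ac)
  finally have "?E \<le> of_nat (?d + 1) * (2 ^ (?d - 1) * fact ?d) * ennreal (?c ^ m * \<beta>)"
    by (subst (asm) ennreal_mult_le_mult_iff) auto
  also have "of_nat (?d + 1) * (2 ^ (?d - 1) * fact ?d) = ennreal (fact (?d + 1) * 2 ^ (?d - 1))"
  proof -
    have "ennreal (fact (?d + 1) * 2 ^ (?d - 1)) = ennreal (real (?d + 1) * (2 ^ (?d - 1) * fact ?d))"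
      by (simp add: algebra_simps)
    also have "\<dots> = ennreal (real (?d + 1)) * (ennreal (2 ^ (?d - 1)) * ennreal (fact ?d))"
      by (subst ennreal_mult, simp, simp)+ simp
    also have "\<dots> = of_nat (?d + 1) * (2 ^ (?d - 1) * fact ?d)"
      by (simp only: ennreal_fact ennreal_of_nat_eq_real_of_nat) (simp add: ennreal_power[symmetric])
    finally show ?thesis ..
  qed
  finally show ?thesis
    unfolding \<beta>_def[symmetric] using \<beta> by (simp add: ennreal_mult[symmetric] mult.assoc del: fact_Suc)
qed

end

section \<open>Summation over islands and their simplices\<close>

lemma prod_ratio_falling:
  assumes "d \<le> n"
  shows "fact n / fact (n - d) = (\<Prod>i<d. real n - real i)"
  using assms
proof (induction d)
  case (Suc d)
  have "fact (n - d) = (real n - real d) * fact (n - Suc d)"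
    using Suc.prems by (subst fact_reduce) (auto simp: of_nat_diff)
  then have "fact n / fact (n - Suc d) = fact n / fact (n - d) * (real n - real d)"
    using Suc.prems by simp
  then show ?case using Suc by simp
qed simp

text \<open>With one of two coinciding vertices as base, the other gives a zero edge and hence a
  zero determinant. This serves to show that the random points are almost surely distinct.\<close>

lemma inj_on_if_simplex_volume_nonzero:
  fixes x :: "'i \<Rightarrow> real^'d"
  assumes T: "finite T" "card T = CARD('d::finite) + 1"
    and v: "measure lborel (convex hull (x ` T)) \<noteq> 0"
  shows "inj_on x T"
proof (rule inj_onI, rule ccontr)
  fix i j assume ij: "i \<in> T" "j \<in> T" "x i = x j" "i \<noteq> j"
  obtain g :: "'d \<Rightarrow> 'i" where g: "i \<notin> range g" "insert i (range g) = T"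
    using exists_simplex_enumeration[OF T ij(1)] by blast
  then obtain r where r: "j = g r" using ij by auto
  then have "row r (\<chi> l. x (g l) - x i) = 0" using ij by (simp add: row_def vec_eq_iff)
  then have "det (\<chi> l. x (g l) - x i) = 0" by (rule det_zero_row)
  then show False using v measure_simplex[of x i g] g(2) by simp
qed

context unit_volume_body
begin

text \<open>Every island contains a simplex of maximal volume, so the number of islands is at most
  the number of pairs \<open>J\<close>, \<open>T\<close> for which \<open>max_simplex_event\<close>
  holds. All pairs share one probability bound, and the numbers of choices of \<open>J\<close> and
  \<open>T\<close> cancel its factorials up to \<open>fact n / fact (n - CARD('d))\<close>.\<close>

lemma nn_integral_num_k_islands_le:
  fixes I :: "'i set"
  assumes d: "2 \<le> CARD('d)" and I: "finite I" "card I = n" and k: "CARD('d) + 1 \<le> k" "k \<le> n"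
  shows "(\<integral>\<^sup>+x. ennreal (real (num_k_islands k (x ` I))) \<partial>PiM I (\<lambda>_. U))
    \<le> ennreal (2 ^ (CARD('d) - 1) * (2 ^ CARD('d) * fact CARD('d)) ^ (k - CARD('d) - 1) * (\<Prod>i<CARD('d). real n - real i))"
proof -
  interpret product_prob_space "\<lambda>_. U" I by (rule product_prob_space_U)
  let ?d = "CARD('d)"
  let ?M = "PiM I (\<lambda>_. U)"
  define m where "m = k - ?d - 1"
  define \<J> where "\<J> = {J. J \<subseteq> I \<and> card J = k}"
  define \<T> where "\<T> J = {T. T \<subseteq> J \<and> card T = ?d + 1}" for J :: "'i set"
  define E where "E J T = {x \<in> space ?M. max_simplex_event I J T x}" for J T
  have finJ: "finite J" if "J \<in> \<J>" for J using that I by (auto simp: \<J>_def intro: finite_subset)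
  have finJs: "finite \<J>"
    by (rule finite_subset[of _ "Pow I"]) (use I in \<open>auto simp: \<J>_def\<close>)
  have finT: "finite (\<T> J)" if "J \<in> \<J>" for J
    by (rule finite_subset[of _ "Pow J"]) (use finJ[OF that] in \<open>auto simp: \<T>_def\<close>)
  have fT: "finite T" if "J \<in> \<J>" "T \<in> \<T> J" for J T
    using finJ[OF that(1)] that(2) by (auto simp: \<T>_def intro: finite_subset)
  have Em: "E J T \<in> sets ?M" if "J \<in> \<J>" "T \<in> \<T> J" for J T
    using measurable_max_simplex_event[of I J T] that I unfolding E_def \<J>_def \<T>_def pred_def by auto
  have AEn: "AE x in ?M. \<forall>T\<in>{T. T \<subseteq> I \<and> card T = ?d + 1}. measure lborel (convex hull (x ` T)) \<noteq> 0"
    using I by (intro AE_finite_allI AE_simplex_volume_nonzero) auto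
  have "AE x in ?M. ennreal (real (num_k_islands k (x ` I))) \<le> (\<Sum>J\<in>\<J>. \<Sum>T\<in>\<T> J. indicator (E J T) x)"
    using AEn AE_space
  proof eventually_elim
    case (elim x)
    have inj: "inj_on x I"
    proof (rule inj_onI)
      fix i j assume ij: "i \<in> I" "j \<in> I" "x i = x j"
      \<comment> \<open>Two coinciding points with different indices would belong to a common
        simplex, which would then have volume zero.\<close>
      have "card {i, j} \<le> ?d + 1" using d by (cases "i = j") auto
      moreover have "?d + 1 \<le> card I" using I k by simp
      ultimately obtain T where T: "{i, j} \<subseteq> T" "T \<subseteq> I" "card T = ?d + 1"
        using ij I obtain_subset_with_card_n exists_subset_between[of "{i, j}" "?d + 1" I] by auto
      then have "inj_on x T"
        using elim I by (intro inj_on_if_simplex_volume_nonzero) (auto intro: finite_subset)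
      then show "i = j" using T ij by (auto dest: inj_onD)
    qed
    define A where "A = {J \<in> Pow I. card (x ` J) = k \<and> (\<forall>j\<in>I - J. x j \<notin> convex hull (x ` J))}"
    have AJ: "A \<subseteq> \<J>"
      using inj by (auto simp: A_def \<J>_def card_image inj_on_subset)
    have one: "(1::ennreal) \<le> (\<Sum>T\<in>\<T> J. indicator (E J T) x)" if J: "J \<in> A" for J
    proof -
      have J': "J \<in> \<J>" using AJ J by auto
      have "?d + 1 \<le> card J" using k J' by (simp add: \<J>_def)
      then obtain T0 where "T0 \<subseteq> J" "card T0 = ?d + 1" by (rule obtain_subset_with_card_n)
      then have ne: "\<T> J \<noteq> {}" by (auto simp: \<T>_def)
      let ?v = "\<lambda>T. measure lborel (convex hull (x ` T))"
      have "Max (?v ` \<T> J) \<in> ?v ` \<T> J" using finT[OF J'] ne by (intro Max_in) auto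
      then obtain T where T: "T \<in> \<T> J" "Max (?v ` \<T> J) = ?v T" by blast
      have mx: "?v T' \<le> ?v T" if "T' \<in> \<T> J" for T'
        using finT[OF J'] that unfolding T(2)[symmetric] by (intro Max_ge) auto
      have "max_simplex_event I J T x"
        unfolding max_simplex_event_def
      proof (intro conjI ballI)
        fix j t assume jt: "j \<in> J - T" "t \<in> T"
        then have "insert j (T - {t}) \<in> \<T> J"
          using T(1) fT[OF J' T(1)] by (auto simp: \<T>_def)
        then show "?v (insert j (T - {t})) \<le> ?v T" by (rule mx)
      next
        fix j assume "j \<in> I - J"
        then have "x j \<notin> convex hull (x ` J)" using J by (auto simp: A_def)
        moreover have "convex hull (x ` T) \<subseteq> convex hull (x ` J)"
          using T(1) by (intro hull_mono image_mono) (auto simp: \<T>_def)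
        ultimately show "x j \<notin> convex hull (x ` T)" by auto
      qed
      then have "(1::ennreal) = indicator (E J T) x" using elim by (simp add: E_def)
      also have "\<dots> \<le> (\<Sum>T\<in>\<T> J. indicator (E J T) x)"
        using finT[OF J'] T(1) by (intro member_le_sum) auto
      finally show ?thesis .
    qed
    have "ennreal (real (num_k_islands k (x ` I))) = (\<Sum>J\<in>A. 1)"
      using I by (simp add: num_k_islands_image A_def ennreal_of_nat_eq_real_of_nat)
    also have "\<dots> \<le> (\<Sum>J\<in>A. \<Sum>T\<in>\<T> J. indicator (E J T) x)"
      by (intro sum_mono one)
    also have "\<dots> \<le> (\<Sum>J\<in>\<J>. \<Sum>T\<in>\<T> J. indicator (E J T) x)"
      using finJs AJ by (intro sum_mono2) auto
    finally show ?case .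
  qed
  then have "(\<integral>\<^sup>+x. ennreal (real (num_k_islands k (x ` I))) \<partial>?M)
      \<le> (\<integral>\<^sup>+x. (\<Sum>J\<in>\<J>. \<Sum>T\<in>\<T> J. indicator (E J T) x) \<partial>?M)"
    by (rule nn_integral_mono_AE)
  also have "\<dots> = (\<Sum>J\<in>\<J>. \<Sum>T\<in>\<T> J. emeasure ?M (E J T))"
    using Em by (simp add: nn_integral_sum)
  also have "\<dots> \<le> (\<Sum>J\<in>\<J>. \<Sum>T\<in>\<T> J. ennreal (fact (?d + 1) * 2 ^ (?d - 1) * (2 ^ ?d * fact ?d) ^ m
        * (fact m * fact (n - k) / fact (n - ?d))))"
  proof (intro sum_mono)
    fix J T assume J: "J \<in> \<J>" and T: "T \<in> \<T> J"
    have "card (J - T) = m" "card (I - J) = n - k"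
      using J T I fT[OF J T] finJ[OF J] k by (auto simp: \<J>_def \<T>_def card_Diff_subset m_def)
    moreover have "m + (n - k) + 1 = n - ?d" using k by (simp add: m_def)
    ultimately show "emeasure ?M (E J T) \<le> ennreal (fact (?d + 1) * 2 ^ (?d - 1) * (2 ^ ?d * fact ?d) ^ m
        * (fact m * fact (n - k) / fact (n - ?d)))"
      using emeasure_max_simplex_event_le_beta[OF d I(1), of J T m "n - k"] J T
      unfolding E_def by (simp only: \<J>_def \<T>_def mem_Collect_eq)
  qed
  also have "\<dots> = ennreal (real (n choose k) * (real (k choose (?d + 1)) * (fact (?d + 1) * 2 ^ (?d - 1) * (2 ^ ?d * fact ?d) ^ m
        * (fact m * fact (n - k) / fact (n - ?d)))))"
    (is "_ = ennreal (_ * (_ * ?B))")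
  proof -
    have B: "0 \<le> ?B" by simp
    have "card (\<T> J) = k choose (?d + 1)" if "J \<in> \<J>" for J
      using n_subsets[OF finJ[OF that], of "?d + 1"] that by (simp add: \<T>_def \<J>_def)
    then have "(\<Sum>J\<in>\<J>. \<Sum>T\<in>\<T> J. ennreal ?B) = (\<Sum>J\<in>\<J>. of_nat (k choose (?d + 1)) * ennreal ?B)"
      by (intro sum.cong) (simp_all only: sum_constant)
    also have "\<dots> = of_nat (n choose k) * (of_nat (k choose (?d + 1)) * ennreal ?B)"
      using n_subsets[OF I(1), of k] I(2) by (simp only: sum_constant \<J>_def)
    also have "\<dots> = ennreal (real (n choose k) * (real (k choose (?d + 1)) * ?B))"
      using B by (simp only: ennreal_of_nat_eq_real_of_nat ennreal_mult of_nat_0_le_iff mult_nonneg_nonneg)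
    finally show ?thesis .
  qed
  also have "real (n choose k) * (real (k choose (?d + 1)) * ?B)
      = 2 ^ (?d - 1) * (2 ^ ?d * fact ?d) ^ m * (\<Prod>i<?d. real n - real i)"
  proof -
    have nk: "real (n choose k) = fact n / (fact k * fact (n - k))"
      using k by (intro binomial_fact) auto
    have kd: "real (k choose (?d + 1)) = fact k / (fact (?d + 1) * fact m)"
      using k binomial_fact[of "?d + 1" k, where 'a = real] by (simp add: m_def)
    have "real (n choose k) * (real (k choose (?d + 1)) * ?B) = 2 ^ (?d - 1) * (2 ^ ?d * fact ?d) ^ m * (fact n / fact (n - ?d))"
      unfolding nk kd by (simp del: fact_Suc)
    then show ?thesis using k by (simp add: prod_ratio_falling)
  qed
  finally show ?thesis by (simp add: m_def)
qed

end

section \<open>Comparison with the claimed bound and its growth\<close>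

lemma two_power_fact_le:
  assumes "2 \<le> d"
  shows "2 ^ d * fact d \<le> real d ^ (2 * d - 1)"
proof -
  have f: "fact d \<le> real d ^ (d - 1)"
  proof -
    \<comment> \<open>Dropping the factor 1 leaves \<open>d - 1\<close> factors, each at most
      \<open>d\<close>.\<close>
    have "fact d = (\<Prod>i=2..d. real i)"
      using assms by (simp add: fact_prod prod.atLeast_Suc_atMost numeral_2_eq_2)
    also have "\<dots> \<le> (\<Prod>i=2..d. real d)" by (intro prod_mono) auto
    finally show ?thesis using assms by simp
  qed
  have "2 ^ d * fact d \<le> real d ^ d * real d ^ (d - 1)"
    using assms f by (intro mult_mono power_mono) auto
  also have "\<dots> = real d ^ (2 * d - 1)"
    using assms by (simp add: power_add[symmetric] mult_2)
  finally show ?thesis .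
qed

text \<open>In the constant, \<open>2 ^ d * fact d\<close> is at most
  \<open>real d ^ (2 * d - 1)\<close>, and the additional factors are at least one. In the quotient,
  the numerator has \<open>k - d - 1\<close> factors after the first \<open>d\<close>, each at least
  \<open>n - k + 1\<close>, so at least the product of the first \<open>d\<close> remains after the
  division.\<close>

lemma le_islands_bound:
  assumes d: "2 \<le> d" and k: "d + 1 \<le> k" "k \<le> n"
  shows "2 ^ (d - 1) * (2 ^ d * fact d) ^ (k - d - 1) * (\<Prod>i<d. real n - real i) \<le> islands_bound d k n"
proof -
  define m where "m = k - d - 1"
  define c where "c = 2 * real d ^ (2 * d - 1) * real (k choose (d div 2))"
  have "0 < k choose (d div 2)" using k by (intro zero_less_binomial) simp
  then have b: "1 \<le> real (k choose (d div 2))" by linarith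
  have "2 ^ d * fact d \<le> real d ^ (2 * d - 1)" using d by (rule two_power_fact_le)
  also have "\<dots> \<le> 2 * real d ^ (2 * d - 1)" by simp
  also have "\<dots> * 1 \<le> c" unfolding c_def using b by (intro mult_left_mono) auto
  finally have c: "(2 ^ d * fact d) ^ m \<le> c ^ m" by (intro power_mono) auto
  have p: "0 < real n - real k + 1" using k by simp
  have "(\<Prod>i<k - 1. real n - real i) = (\<Prod>i<d. real n - real i) * (\<Prod>i=d..<k - 1. real n - real i)"
    using k by (subst prod.union_disjoint[symmetric]) (auto intro!: prod.cong)
  moreover have "(real n - real k + 1) ^ m \<le> (\<Prod>i=d..<k - 1. real n - real i)"
  proof -
    have "(real n - real k + 1) ^ m = (\<Prod>i=d..<k - 1. real n - real k + 1)" using k by (simp add: m_def)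
    also have "\<dots> \<le> (\<Prod>i=d..<k - 1. real n - real i)" using p k by (intro prod_mono) auto
    finally show ?thesis .
  qed
  moreover have P0: "0 \<le> (\<Prod>i<d. real n - real i)" using k by (intro prod_nonneg) auto
  ultimately have "(\<Prod>i<d. real n - real i) * (real n - real k + 1) ^ m \<le> (\<Prod>i<k - 1. real n - real i)"
    by (simp add: mult_left_mono)
  then have q: "(\<Prod>i<d. real n - real i) \<le> (\<Prod>i<k - 1. real n - real i) / (real n - real k + 1) ^ m"
    using p by (simp add: pos_le_divide_eq)
  have "2 ^ (d - 1) * (2 ^ d * fact d) ^ m * (\<Prod>i<d. real n - real i)
      \<le> 2 ^ (d - 1) * (c ^ m * (real k - real d)) * ((\<Prod>i<k - 1. real n - real i) / (real n - real k + 1) ^ m)"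
  proof (intro mult_mono q mult_left_mono)
    have "1 \<le> real k - real d" using k by simp
    then have "c ^ m * 1 \<le> c ^ m * (real k - real d)" unfolding c_def by (intro mult_left_mono) auto
    then show "(2 ^ d * fact d) ^ m \<le> c ^ m * (real k - real d)" using c by simp
  qed (use P0 k in \<open>auto simp: c_def\<close>)
  then show ?thesis by (simp add: islands_bound_def m_def c_def mult.assoc)
qed

text \<open>For \<open>n \<ge> 2 * k\<close> the numerator is at most \<open>n ^ (k - 1)\<close> and
  the base of the denominator at least \<open>n / 2\<close>. The exponents \<open>k - 1\<close> and
  \<open>k - d - 1\<close> differ by \<open>d\<close>.\<close>

lemma islands_bound_bigo:
  assumes k: "d + 1 \<le> k"
  shows "(\<lambda>n. islands_bound d k n) \<in> O(\<lambda>n. real n ^ d)"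
proof -
  define m where "m = k - d - 1"
  define C where "C = 2 ^ (d - 1) * (2 * real d ^ (2 * d - 1) * real (k choose (d div 2))) ^ m * (real k - real d)"
  have C0: "0 \<le> C" using k by (simp add: C_def)
  have "norm (islands_bound d k n) \<le> (C * 2 ^ m) * norm (real n ^ d)" if n: "2 * k \<le> n" for n
  proof -
    let ?q = "(\<Prod>i<k - 1. real n - real i) / (real n - real k + 1) ^ m"
    have pn: "0 < real n" using n k by simp
    have p: "real n / 2 \<le> real n - real k + 1" using n by simp
    have P0: "0 \<le> (\<Prod>i<k - 1. real n - real i)" using n by (intro prod_nonneg) auto
    have "(\<Prod>i<k - 1. real n - real i) \<le> (\<Prod>i<k - 1. real n)" using n by (intro prod_mono) auto
    then have "?q \<le> real n ^ (k - 1) / (real n / 2) ^ m"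
      using p pn P0 by (intro frac_le power_mono) auto
    also have "real n ^ (k - 1) = real n ^ d * real n ^ m"
      using k by (simp add: m_def power_add[symmetric])
    also have "real n ^ d * real n ^ m / (real n / 2) ^ m = 2 ^ m * real n ^ d"
      using pn by (simp add: power_divide)
    finally have q: "?q \<le> 2 ^ m * real n ^ d" .
    have q0: "0 \<le> ?q" using P0 p pn by auto
    have eq: "islands_bound d k n = C * ?q" by (simp add: islands_bound_def C_def m_def)
    have "norm (islands_bound d k n) = C * ?q"
      unfolding eq real_norm_def using C0 q0 by (intro abs_of_nonneg mult_nonneg_nonneg)
    also have "\<dots> \<le> C * (2 ^ m * real n ^ d)" by (rule mult_left_mono[OF q C0])
    finally show ?thesis by (simp add: mult.assoc)
  qed
  then have "eventually (\<lambda>n. norm (islands_bound d k n) \<le> (C * 2 ^ m) * norm (real n ^ d)) at_top"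
    by (rule eventually_mono[OF eventually_ge_at_top[of "2 * k"]])
  then show ?thesis by (rule bigoI)
qed

section \<open>Transfer from the product measure to independent random points\<close>

theorem theorem1:
  fixes K :: "(real ^ 'd) set"
    and M :: "'w measure"
    and X :: "nat \<Rightarrow> 'w \<Rightarrow> real ^ 'd"
    and k n :: nat
  assumes "CARD('d) \<ge> 2"
    and "k \<ge> CARD('d) + 1"
    and "convex_body K"
    and "measure lborel K = 1"
    and "n \<ge> k"
    and "prob_space M"
    and "prob_space.indep_vars M (\<lambda>_. borel) X {..<n}"
    and "\<And>i. i < n \<Longrightarrow> distr M borel (X i) = uniform_measure lborel K"
  shows "integrable M (\<lambda>\<omega>. real (num_k_islands k ((\<lambda>i. X i \<omega>) ` {..<n})))
    \<and> (\<integral>\<omega>. real (num_k_islands k ((\<lambda>i. X i \<omega>) ` {..<n})) \<partial>M) \<le> islands_bound CARD('d) k n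
    \<and> (\<lambda>m. islands_bound CARD('d) k m) \<in> O(\<lambda>m. real m ^ CARD('d))"
proof -
  interpret prob_space M by fact
  interpret unit_volume_body K
  proof
    show "compact K" "convex K" using assms(3) by (auto simp: convex_body_def)
    then show "emeasure lborel K = 1"
      using assms(4) emeasure_compact_finite[of K] by (simp add: emeasure_eq_ennreal_measure)
  qed
  let ?I = "{..<n}"
  let ?f = "\<lambda>\<omega>. real (num_k_islands k ((\<lambda>i. X i \<omega>) ` ?I))"
  let ?Y = "\<lambda>\<omega>. \<lambda>i\<in>?I. X i \<omega>"
  have Xm: "X i \<in> borel_measurable M" if "i \<in> ?I" for i
    using assms(7) that by (auto simp: indep_vars_def)
  have fm: "?f \<in> borel_measurable M" using Xm by (intro measurable_num_k_islands) auto
  \<comment> \<open>The characterization of independence by a product law is applied to a nonempty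
    index set.\<close>
  have "0 \<in> ?I" using assms(2,5) by simp
  then have "?I \<noteq> {}" by blast
  then have "distr M (PiM ?I (\<lambda>_. borel)) ?Y = PiM ?I (\<lambda>i. distr M borel (X i))"
    using assms(7) Xm by (subst (asm) indep_vars_iff_distr_eq_PiM') auto
  also have "\<dots> = PiM ?I (\<lambda>_. U)" using assms(8) by (intro PiM_cong) (auto simp: U_def)
  finally have distr: "distr M (PiM ?I (\<lambda>_. borel)) ?Y = PiM ?I (\<lambda>_. U)" .
  have Ym: "?Y \<in> measurable M (PiM ?I (\<lambda>_. borel))" using Xm by (intro measurable_restrict) auto
  have nm: "(\<lambda>x. real (num_k_islands k (x ` ?I))) \<in> borel_measurable (PiM ?I (\<lambda>_. borel :: (real^'d) measure))"
    using measurable_num_k_islands[of ?I "\<lambda>i x. x i" "PiM ?I (\<lambda>_. borel)"] by simp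
  have "(\<integral>\<^sup>+\<omega>. ennreal (?f \<omega>) \<partial>M) = (\<integral>\<^sup>+\<omega>. ennreal (real (num_k_islands k (?Y \<omega> ` ?I))) \<partial>M)"
  proof (rule nn_integral_cong)
    fix \<omega>
    have "?Y \<omega> ` ?I = (\<lambda>i. X i \<omega>) ` ?I" by (intro image_cong) auto
    then show "ennreal (?f \<omega>) = ennreal (real (num_k_islands k (?Y \<omega> ` ?I)))" by (simp only:)
  qed
  also have "\<dots> = (\<integral>\<^sup>+x. ennreal (real (num_k_islands k (x ` ?I))) \<partial>distr M (PiM ?I (\<lambda>_. borel)) ?Y)"
    using Ym nm by (subst nn_integral_distr) auto
  also have "\<dots> = (\<integral>\<^sup>+x. ennreal (real (num_k_islands k (x ` ?I))) \<partial>PiM ?I (\<lambda>_. U))"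
    unfolding distr ..
  also have "\<dots> \<le> ennreal (2 ^ (CARD('d) - 1) * (2 ^ CARD('d) * fact CARD('d)) ^ (k - CARD('d) - 1) * (\<Prod>i<CARD('d). real n - real i))"
    using assms by (intro nn_integral_num_k_islands_le) auto
  also have "\<dots> \<le> ennreal (islands_bound CARD('d) k n)"
    using assms by (intro ennreal_leI le_islands_bound) auto
  finally have le: "(\<integral>\<^sup>+\<omega>. ennreal (?f \<omega>) \<partial>M) \<le> ennreal (islands_bound CARD('d) k n)" .
  have int: "integrable M ?f"
    using fm le by (intro integrableI_bounded) (auto simp: less_top[symmetric] top_unique)
  \<comment> \<open>Nonnegativity carries the inequality from \<open>ennreal\<close> back to the
    reals. It is inherited from the smaller bound, all of whose factors are nonnegative.\<close>
  have B0: "0 \<le> islands_bound CARD('d) k n"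
  proof -
    have "0 \<le> 2 ^ (CARD('d) - 1) * (2 ^ CARD('d) * fact CARD('d)) ^ (k - CARD('d) - 1) * (\<Prod>i<CARD('d). real n - real i)"
      using assms by (intro mult_nonneg_nonneg prod_nonneg) auto
    then show ?thesis using le_islands_bound[OF assms(1,2,5)] by linarith
  qed
  have "ennreal (\<integral>\<omega>. ?f \<omega> \<partial>M) \<le> ennreal (islands_bound CARD('d) k n)"
    using le int by (subst (asm) nn_integral_eq_integral) auto
  then have "(\<integral>\<omega>. ?f \<omega> \<partial>M) \<le> islands_bound CARD('d) k n"
    using B0 by (simp add: ennreal_le_iff)
  with int islands_bound_bigo[OF assms(2)] show ?thesis by blast
qed

end
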